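(* For any $\alpha\in Q_n^\kappa$, when one restricts a Specht module $\mathcal{S}^\lambda$ with $\lambda\in\mathcal{P}^\kappa_{[\alpha]}$ (that is, a Specht module of $\mathcal{H}^\kappa_{[\alpha]}$), the maximal number of summands in the decomposition \[ \mathcal{S}^{\lambda}\big\downarrow^{\mathcal{H}_n^\kappa}_{\mathcal{H}_{p,n}^\kappa}\simeq\mathcal{S}^\lambda_0\oplus\cdots\oplus\mathcal{S}^\lambda_{\frac{p}{\#[\lambda]}-1} \] into Specht modules of $\mathcal{H}_{p,n}^\kappa$ is $\frac{p}{\#[\alpha]}$, and this bound is reached (for some $\lambda\in\mathcal{P}^\kappa_{[\alpha]}$).
   Context: Combinatorics. Let $d,\eta,p,n\geq 1$ be integers, $e:=\eta p\ge 2$, $r:=dp$; identify $\mathbb{Z}/e\mathbb{Z}$ with $\{0,\dots,e-1\}$ and $\mathbb{Z}/r\mathbb{Z}$ with $\{0,\dots,r-1\}$. Let $\kappa=(\kappa_0,\dots,\kappa_{r-1})\in(\mathbb{Z}/e\mathbb{Z})^r$ satisfy $\kappa_{k+d}=\kappa_k+\eta$ for all $k\in\mathbb{Z}/r\mathbb{Z}$. An $r$-partition of $n$ is an $r$-tuple $\lambda=(\lambda^{(0)},\dots,\lambda^{(r-1)})$ of partitions of total size $n$; $\mathcal{P}_n^\kappa$ is the set of these. Its Young diagram is $\mathcal{Y}(\lambda)=\{(a,b,c)\in \mathbb{N}^2\times\{0,\dots,r-1\} : a\text{ indexes a row of }\lambda^{(c)},\ 0\le b\le\lambda^{(c)}_a-1\}$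 (rows indexed from $0$), and $\mathrm{res}_\kappa(a,b,c)=b-a+\kappa_c\in\mathbb{Z}/e\mathbb{Z}$. Let $Q^+=\bigoplus_{i\in\mathbb{Z}/e\mathbb{Z}}\mathbb{N}\alpha_i$, $\alpha_\kappa(\lambda)=\sum_{\gamma\in\mathcal{Y}(\lambda)}\alpha_{\mathrm{res}_\kappa(\gamma)}$, $Q^\kappa_n=\{\alpha_\kappa(\lambda):\lambda\in\mathcal{P}^\kappa_n\}$ and $\mathcal{P}_\alpha^\kappa=\{\lambda:\alpha_\kappa(\lambda)=\alpha\}$. The shift on $Q^+$ is the additive map with $\sigma\cdot\alpha_i=\alpha_{i+\eta}$; on $r$-partitions ${}^\sigma\lambda=(\lambda^{(r-d)},\dots,\lambda^{(r-1)},\lambda^{(0)},\dots,\lambda^{(r-d-1)})$. Orbits are denoted $[\alpha]$, $[\lambda]$, and $\mathcal{P}^\kappa_{[\alpha]}=\bigcup_{\beta\in[\alpha]}\mathcal{P}^\kappa_\beta$. Algebra. Let $F$ be a field and $q\in F\setminus\{0,1\}$ of multiplicative order $e$. The Ariki--Koike algebra $\mathcal{H}_n^\kappa$ is the unital associative $F$-algebra with generators $S,T_1,\dots,T_{n-1}$ and relations $\prod_{k=0}^{r-1}(S-q^{\kappa_k})=0$, $ST_1ST_1=T_1ST_1S$, $ST_a=T_aS$ for $a\ge 2$, $(T_a+1)(T_a-q)=0$, $T_aT_b=T_bT_a$ for $|a-b|>1$, $T_aT_{a+1}T_a=T_{a+1}T_aT_{a+1}$. Let $\zeta\in F^\times$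 have order $p$, let $\sigma$ be the algebra automorphism of $\mathcal{H}_n^\kappa$ of order $p$ with $\sigma(S)=\zeta S$, $\sigma(T_a)=T_a$, and let $\mathcal{H}_{p,n}^\kappa$ be the subalgebra of elements fixed by $\sigma$. The algebra $\mathcal{H}_n^\kappa$ is cellular (Graham--Lehrer) with a cellular basis $\{c^\lambda_{\mathfrak{s}\mathfrak{t}}\}$ indexed by $\lambda\in\mathcal{P}_n^\kappa$ and standard $\lambda$-tableaux $\mathfrak{s},\mathfrak{t}$ (Hu--Mathas); the corresponding cell modules $\mathcal{S}^\lambda$, $\lambda\in\mathcal{P}_n^\kappa$, are called Specht modules of $\mathcal{H}_n^\kappa$. The algebra $\mathcal{H}^\kappa_{[\alpha]}$ is the direct sum of the blocks $\mathcal{H}^\kappa_\beta$ of $\mathcal{H}^\kappa_n$ for $\beta\in[\alpha]$, where $\mathcal{H}^\kappa_\beta$ is the block whose Specht modules are the $\mathcal{S}^\lambda$ with $\lambda\in\mathcal{P}^\kappa_\beta$ (Lyle--Mathas). Hu and Mathas defined, for each $\lambda\in\mathcal{P}_n^\kappa$, a family $\mathcal{S}^\lambda_0,\dots,\mathcal{S}^\lambda_{p/\#[\lambda]-1}$ of $\mathcal{H}_{p,n}^\kappa$-modules, also called Specht modules (of $\mathcal{H}_{p,n}^\kappa$), pairwise isomorphic up to a twist of the action of $\mathcal{H}^\kappa_{p,n}$, such that the restriction of $\mathcal{S}^\lambda$ to $\mathcal{H}^\kappa_{p,n}$ is isomorphic to their direct sum, as displayed in the claim. For the claim only the number $p/\#[\lambda]$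 of summands of this decomposition matters. *)

theory Defs
  imports
    "HOL-Library.Multiset"
    "HOL-Library.FuncSet"
    "HOL-Library.Poly_Mapping"
    "HOL-Algebra.QuotRing"
    "HOL-Algebra.Module"
begin

section \<open>Combinatorics of multipartitions\<close>

text \<open>A partition is the list of its nonzero parts; an \<open>r\<close>-partition is a list of length \<open>r\<close>.\<close>

type_synonym multipartition = "nat list list"
type_synonym node = "nat \<times> nat \<times> nat"

definition is_partition :: "nat list \<Rightarrow> bool" where
  "is_partition \<mu> \<longleftrightarrow> sorted_wrt (\<ge>) \<mu> \<and> 0 \<notin> set \<mu>"

definition multipartitions :: "nat \<Rightarrow> nat \<Rightarrow> multipartition set" where
  "multipartitions r n =
     {lam. length lam = r \<and> (\<forall>\<mu>\<in>set lam. is_partition \<mu>) \<and> sum_list (map sum_list lam) = n}"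

definition young :: "multipartition \<Rightarrow> node set" where
  "young lam = {(a, b, c). c < length lam \<and> a < length (lam ! c) \<and> b < lam ! c ! a}"

text \<open>Elements of \<open>\<int>/e\<int>\<close> are represented by natural numbers below \<open>e\<close>.\<close>

definition residue :: "nat \<Rightarrow> (nat \<Rightarrow> nat) \<Rightarrow> node \<Rightarrow> nat" where
  "residue e \<kappa> = (\<lambda>(a, b, c). nat ((int b - int a + int (\<kappa> c)) mod int e))"

text \<open>
  The free commutative monoid \<open>Q\<^sup>+\<close> on the \<open>\<alpha>\<^sub>i\<close>, \<open>i \<in> \<int>/e\<int>\<close>, is the monoid of finite multisets
  of residues, with \<open>\<alpha>\<^sub>i\<close> the singleton \<open>{#i#}\<close>.
\<close>

definition content :: "nat \<Rightarrow> (nat \<Rightarrow> nat) \<Rightarrow> multipartition \<Rightarrow> nat multiset" where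
  "content e \<kappa> lam = (\<Sum>\<gamma>\<in>young lam. {#residue e \<kappa> \<gamma>#})"

definition contents :: "nat \<Rightarrow> (nat \<Rightarrow> nat) \<Rightarrow> nat \<Rightarrow> nat \<Rightarrow> nat multiset set" where
  "contents e \<kappa> r n = content e \<kappa> ` multipartitions r n"

definition multipartitions_of_content ::
    "nat \<Rightarrow> (nat \<Rightarrow> nat) \<Rightarrow> nat \<Rightarrow> nat \<Rightarrow> nat multiset \<Rightarrow> multipartition set" where
  "multipartitions_of_content e \<kappa> r n \<alpha> = {lam \<in> multipartitions r n. content e \<kappa> lam = \<alpha>}"

definition content_shift :: "nat \<Rightarrow> nat \<Rightarrow> nat multiset \<Rightarrow> nat multiset" where
  "content_shift e \<eta> \<alpha> = image_mset (\<lambda>i. (i + \<eta>) mod e) \<alpha>"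

definition multipartition_shift :: "nat \<Rightarrow> multipartition \<Rightarrow> multipartition" where
  "multipartition_shift d lam = drop (length lam - d) lam @ take (length lam - d) lam"

text \<open>
  Both shifts have order dividing \<open>p\<close> where they are used, so the orbit under the generated cyclic
  group is the forward orbit.
\<close>

definition shift_orbit :: "('x \<Rightarrow> 'x) \<Rightarrow> 'x \<Rightarrow> 'x set" where
  "shift_orbit f x = range (\<lambda>k::nat. (f ^^ k) x)"

definition multipartitions_of_orbit ::
    "nat \<Rightarrow> (nat \<Rightarrow> nat) \<Rightarrow> nat \<Rightarrow> nat \<Rightarrow> nat \<Rightarrow> nat multiset \<Rightarrow> multipartition set" where
  "multipartitions_of_orbit e \<kappa> r n \<eta> \<alpha> =
     (\<Union>\<beta>\<in>shift_orbit (content_shift e \<eta>) \<alpha>. multipartitions_of_content e \<kappa> r n \<beta>)"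

definition standard_tableaux :: "nat \<Rightarrow> multipartition \<Rightarrow> (node \<Rightarrow> nat) set" where
  "standard_tableaux n lam =
     {t \<in> young lam \<rightarrow>\<^sub>E {1..n}. bij_betw t (young lam) {1..n} \<and>
        (\<forall>a b b' c. (a, b, c) \<in> young lam \<and> (a, b', c) \<in> young lam \<and> b < b'
            \<longrightarrow> t (a, b, c) < t (a, b', c)) \<and>
        (\<forall>a a' b c. (a, b, c) \<in> young lam \<and> (a', b, c) \<in> young lam \<and> a < a'
            \<longrightarrow> t (a, b, c) < t (a', b, c))}"


section \<open>Algebras given by generators and relations\<close>

text \<open>
  The free algebra on a set of generators is the algebra of the free monoid of words. The type of
  words is made an additive monoid, so that multiplication of finitely supported functions is
  convolution.
\<close>

datatype 'g free_word = Free_Word (letters: "'g list")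

instantiation free_word :: (type) monoid_add
begin
definition "0 = Free_Word []"
definition "u + v = Free_Word (letters u @ letters v)"
instance by standard (simp_all add: zero_free_word_def plus_free_word_def)
end

type_synonym ('g, 'f) free_elt = "'g free_word \<Rightarrow>\<^sub>0 'f"

definition free_gen :: "'g \<Rightarrow> ('g, 'f::field) free_elt" where
  "free_gen g = Poly_Mapping.single (Free_Word [g]) 1"

definition free_scalar :: "'f \<Rightarrow> ('g, 'f::field) free_elt" where
  "free_scalar c = Poly_Mapping.single 0 c"

definition free_algebra :: "'g set \<Rightarrow> ('g, 'f::field) free_elt ring" where
  "free_algebra X =
     \<lparr>carrier = {f. \<forall>w\<in>Poly_Mapping.keys f. set (letters w) \<subseteq> X},
      mult = (*), one = 1, zero = 0, add = (+)\<rparr>"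

definition presented_algebra ::
    "'g set \<Rightarrow> ('g, 'f::field) free_elt set \<Rightarrow> ('g, 'f) free_elt set ring" where
  "presented_algebra X rels = free_algebra X Quot (Idl\<^bsub>free_algebra X\<^esub> rels)"

definition presented_class ::
    "'g set \<Rightarrow> ('g, 'f::field) free_elt set \<Rightarrow> ('g, 'f) free_elt \<Rightarrow> ('g, 'f) free_elt set" where
  "presented_class X rels f = (Idl\<^bsub>free_algebra X\<^esub> rels) +>\<^bsub>free_algebra X\<^esub> f"

lemma keys_uminus_poly: "Poly_Mapping.keys (- f) = Poly_Mapping.keys (f :: 'a \<Rightarrow>\<^sub>0 'b::ab_group_add)"
  by (auto simp: in_keys_iff)

lemma ring_free_algebra: "ring (free_algebra X :: ('g, 'f::field) free_elt ring)"
proof (rule ringI)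
  let ?A = "free_algebra X :: ('g, 'f) free_elt ring"
  show "abelian_group ?A"
  proof (rule abelian_groupI)
    fix x y z assume "x \<in> carrier ?A" "y \<in> carrier ?A"
    then show "x \<oplus>\<^bsub>?A\<^esub> y \<in> carrier ?A"
      using Poly_Mapping.keys_add[of x y] by (auto simp: free_algebra_def)
  next
    fix x assume "x \<in> carrier ?A"
    then show "\<exists>y\<in>carrier ?A. y \<oplus>\<^bsub>?A\<^esub> x = \<zero>\<^bsub>?A\<^esub>"
      by (intro bexI[of _ "- x"]) (auto simp: free_algebra_def keys_uminus_poly)
  qed (auto simp: free_algebra_def add.assoc add.commute)
  show "monoid ?A"
  proof (rule monoidI)
    fix x y assume xy: "x \<in> carrier ?A" "y \<in> carrier ?A"
    show "x \<otimes>\<^bsub>?A\<^esub> y \<in> carrier ?A"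
      using xy Poly_Mapping.keys_mult[of x y] by (fastforce simp: free_algebra_def plus_free_word_def)
  next
    show "\<one>\<^bsub>?A\<^esub> \<in> carrier ?A"
      by (simp add: free_algebra_def zero_free_word_def flip: single_one)
  qed (simp_all add: free_algebra_def mult.assoc)
qed (auto simp: free_algebra_def algebra_simps)

lemma ring_presented_algebra:
  assumes "rels \<subseteq> carrier (free_algebra X)"
  shows "ring (presented_algebra X rels)"
  unfolding presented_algebra_def
  by (intro ideal.quotient_is_ring ring.genideal_ideal ring_free_algebra assms)


section \<open>The Ariki--Koike algebra\<close>

datatype ak_gen = S_gen | T_gen nat

definition ak_gens :: "nat \<Rightarrow> ak_gen set" where
  "ak_gens n = insert S_gen (T_gen ` {1..<n})"

definition ak_relators :: "'f::field \<Rightarrow> (nat \<Rightarrow> nat) \<Rightarrow> nat \<Rightarrow> nat \<Rightarrow> (ak_gen, 'f) free_elt set" where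
  "ak_relators q \<kappa> r n = (let S = free_gen S_gen; T = (\<lambda>a. free_gen (T_gen a)) in
     {prod_list (map (\<lambda>k. S - free_scalar (q ^ \<kappa> k)) [0..<r])}
     \<union> (if 2 \<le> n then {S * T 1 * S * T 1 - T 1 * S * T 1 * S} else {})
     \<union> {S * T a - T a * S | a. 2 \<le> a \<and> a < n}
     \<union> {(T a + 1) * (T a - free_scalar q) | a. 1 \<le> a \<and> a < n}
     \<union> {T a * T b - T b * T a | a b. 1 \<le> a \<and> a < n \<and> 1 \<le> b \<and> b < n \<and> (a + 1 < b \<or> b + 1 < a)}
     \<union> {T a * T (a + 1) * T a - T (a + 1) * T a * T (a + 1) | a. 1 \<le> a \<and> a + 1 < n})"

definition ariki_koike ::
    "'f::field \<Rightarrow> (nat \<Rightarrow> nat) \<Rightarrow> nat \<Rightarrow> nat \<Rightarrow> (ak_gen, 'f) free_elt set ring" where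
  "ariki_koike q \<kappa> r n = presented_algebra (ak_gens n) (ak_relators q \<kappa> r n)"

definition ak_scalar ::
    "'f::field \<Rightarrow> (nat \<Rightarrow> nat) \<Rightarrow> nat \<Rightarrow> nat \<Rightarrow> 'f \<Rightarrow> (ak_gen, 'f) free_elt set" where
  "ak_scalar q \<kappa> r n c = presented_class (ak_gens n) (ak_relators q \<kappa> r n) (free_scalar c)"

definition ak_S :: "'f::field \<Rightarrow> (nat \<Rightarrow> nat) \<Rightarrow> nat \<Rightarrow> nat \<Rightarrow> (ak_gen, 'f) free_elt set" where
  "ak_S q \<kappa> r n = presented_class (ak_gens n) (ak_relators q \<kappa> r n) (free_gen S_gen)"

definition ak_T :: "'f::field \<Rightarrow> (nat \<Rightarrow> nat) \<Rightarrow> nat \<Rightarrow> nat \<Rightarrow> nat \<Rightarrow> (ak_gen, 'f) free_elt set" where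
  "ak_T q \<kappa> r n a = presented_class (ak_gens n) (ak_relators q \<kappa> r n) (free_gen (T_gen a))"

lemma free_algebra_gen: "free_gen g \<in> carrier (free_algebra X :: ('g, 'f::field) free_elt ring) \<longleftrightarrow> g \<in> X"
  by (simp add: free_algebra_def free_gen_def)

lemma free_algebra_scalar: "free_scalar c \<in> carrier (free_algebra X)"
  by (simp add: free_algebra_def free_scalar_def zero_free_word_def)

lemma free_algebra_closed:
  assumes "x \<in> carrier (free_algebra X)" "y \<in> carrier (free_algebra X)"
  shows "x + y \<in> carrier (free_algebra X)" "x - y \<in> carrier (free_algebra X)"
    "x * y \<in> carrier (free_algebra X)"
proof -
  interpret ring "free_algebra X" by (rule ring_free_algebra)
  show "x + y \<in> carrier (free_algebra X)" "x * y \<in> carrier (free_algebra X)"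
    using add.m_closed[OF assms] m_closed[OF assms] by (simp_all add: free_algebra_def)
  have "- y \<in> carrier (free_algebra X)"
    using assms(2) by (simp add: free_algebra_def keys_uminus_poly)
  from add.m_closed[OF assms(1) this] show "x - y \<in> carrier (free_algebra X)"
    by (simp add: free_algebra_def)
qed

lemma free_algebra_one: "1 \<in> carrier (free_algebra X)"
  using free_algebra_scalar[of 1 X] by (simp add: free_scalar_def)

lemma free_algebra_prod_list:
  "set xs \<subseteq> carrier (free_algebra X) \<Longrightarrow> prod_list xs \<in> carrier (free_algebra X)"
  by (induction xs) (auto intro: free_algebra_one free_algebra_closed)

lemma ak_relators_subset: "ak_relators q \<kappa> r n \<subseteq> carrier (free_algebra (ak_gens n))"
  unfolding ak_relators_def Let_def
  by (auto intro!: free_algebra_closed free_algebra_prod_list free_algebra_scalar free_algebra_one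
      simp: free_algebra_gen ak_gens_def)

lemma ring_ariki_koike: "ring (ariki_koike q \<kappa> r n)"
  unfolding ariki_koike_def by (intro ring_presented_algebra ak_relators_subset)

definition has_mult_order :: "'f::field \<Rightarrow> nat \<Rightarrow> bool" where
  "has_mult_order x m \<longleftrightarrow> m \<ge> 1 \<and> (\<forall>k. x ^ k = 1 \<longleftrightarrow> m dvd k)"

definition ak_shift_automorphism ::
    "'f::field \<Rightarrow> (nat \<Rightarrow> nat) \<Rightarrow> nat \<Rightarrow> nat \<Rightarrow> nat \<Rightarrow> 'f
      \<Rightarrow> ((ak_gen, 'f) free_elt set \<Rightarrow> (ak_gen, 'f) free_elt set) \<Rightarrow> bool" where
  "ak_shift_automorphism q \<kappa> r n p \<zeta> \<sigma> \<longleftrightarrow> (let H = ariki_koike q \<kappa> r n in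
     \<sigma> \<in> ring_iso H H \<and>
     (\<forall>c. \<sigma> (ak_scalar q \<kappa> r n c) = ak_scalar q \<kappa> r n c) \<and>
     \<sigma> (ak_S q \<kappa> r n) = ak_scalar q \<kappa> r n \<zeta> \<otimes>\<^bsub>H\<^esub> ak_S q \<kappa> r n \<and>
     (\<forall>a. 1 \<le> a \<and> a < n \<longrightarrow> \<sigma> (ak_T q \<kappa> r n a) = ak_T q \<kappa> r n a) \<and>
     (\<forall>j. (\<forall>h\<in>carrier H. (\<sigma> ^^ j) h = h) \<longleftrightarrow> p dvd j))"

definition fixed_subring :: "('a, 'b) ring_scheme \<Rightarrow> ('a \<Rightarrow> 'a) \<Rightarrow> ('a, 'b) ring_scheme" where
  "fixed_subring R \<sigma> = R\<lparr>carrier := {x \<in> carrier R. \<sigma> x = x}\<rparr>"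


section \<open>Modules over noncommutative rings\<close>

text \<open>
  The locale \<open>module\<close> of HOL-Algebra needs a commutative ring; we keep its record type. For an
  algebra over a field whose scalars are contained in the ring, the vector space structure is part
  of the module structure.
\<close>

locale left_module = R?: ring R + M?: abelian_group M
  for R :: "('a, 'c) ring_scheme" (structure) and M :: "('a, 'm, 'd) module_scheme" (structure) +
  assumes smult_closed: "\<lbrakk>a \<in> carrier R; x \<in> carrier M\<rbrakk> \<Longrightarrow> a \<odot>\<^bsub>M\<^esub> x \<in> carrier M"
    and smult_l_distr: "\<lbrakk>a \<in> carrier R; b \<in> carrier R; x \<in> carrier M\<rbrakk>
      \<Longrightarrow> (a \<oplus>\<^bsub>R\<^esub> b) \<odot>\<^bsub>M\<^esub> x = a \<odot>\<^bsub>M\<^esub> x \<oplus>\<^bsub>M\<^esub> b \<odot>\<^bsub>M\<^esub> x"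
    and smult_r_distr: "\<lbrakk>a \<in> carrier R; x \<in> carrier M; y \<in> carrier M\<rbrakk>
      \<Longrightarrow> a \<odot>\<^bsub>M\<^esub> (x \<oplus>\<^bsub>M\<^esub> y) = a \<odot>\<^bsub>M\<^esub> x \<oplus>\<^bsub>M\<^esub> a \<odot>\<^bsub>M\<^esub> y"
    and smult_assoc: "\<lbrakk>a \<in> carrier R; b \<in> carrier R; x \<in> carrier M\<rbrakk>
      \<Longrightarrow> (a \<otimes>\<^bsub>R\<^esub> b) \<odot>\<^bsub>M\<^esub> x = a \<odot>\<^bsub>M\<^esub> (b \<odot>\<^bsub>M\<^esub> x)"
    and smult_one: "x \<in> carrier M \<Longrightarrow> \<one>\<^bsub>R\<^esub> \<odot>\<^bsub>M\<^esub> x = x"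

text \<open>
  Only the action of \<open>carrier R\<close> enters, so for a subring \<open>R\<close> of \<open>R'\<close> and \<open>R'\<close>-modules \<open>M\<close>, \<open>N\<close>
  this is isomorphism of the restrictions to \<open>R\<close>.
\<close>

definition modules_isomorphic ::
    "('a, 'c) ring_scheme \<Rightarrow> ('a, 'm, 'd) module_scheme \<Rightarrow> ('a, 'k, 'l) module_scheme \<Rightarrow> bool" where
  "modules_isomorphic R M N \<longleftrightarrow> (\<exists>f. bij_betw f (carrier M) (carrier N) \<and>
     (\<forall>x\<in>carrier M. \<forall>y\<in>carrier M. f (x \<oplus>\<^bsub>M\<^esub> y) = f x \<oplus>\<^bsub>N\<^esub> f y) \<and>
     (\<forall>a\<in>carrier R. \<forall>x\<in>carrier M. f (a \<odot>\<^bsub>M\<^esub> x) = a \<odot>\<^bsub>N\<^esub> f x))"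

definition twisted_module ::
    "('a \<Rightarrow> 'a) \<Rightarrow> ('a, 'm, 'd) module_scheme \<Rightarrow> ('a, 'm, 'd) module_scheme" where
  "twisted_module \<tau> M = M\<lparr>smult := (\<lambda>a x. \<tau> a \<odot>\<^bsub>M\<^esub> x)\<rparr>"

text \<open>The ring fields \<open>mult\<close> and \<open>one\<close> of a module record play no role.\<close>

definition module_direct_sum :: "('a, 'm) module list \<Rightarrow> ('a, nat \<Rightarrow> 'm) module" where
  "module_direct_sum Ms =
     \<lparr>carrier = (\<Pi>\<^sub>E j\<in>{..<length Ms}. carrier (Ms ! j)),
      mult = undefined, one = undefined,
      zero = (\<lambda>j\<in>{..<length Ms}. \<zero>\<^bsub>Ms ! j\<^esub>),
      add = (\<lambda>x y. \<lambda>j\<in>{..<length Ms}. x j \<oplus>\<^bsub>Ms ! j\<^esub> y j),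
      smult = (\<lambda>a x. \<lambda>j\<in>{..<length Ms}. a \<odot>\<^bsub>Ms ! j\<^esub> x j)\<rparr>"


section \<open>Cellular algebras and cell modules\<close>

text \<open>
  Throughout, \<open>\<iota>\<close> is the structure map of an algebra \<open>A\<close> over a field, \<open>\<Lambda>\<close> is the finite set of
  cells with its strict order \<open>prec\<close>, \<open>M l\<close> is the index set attached to the cell \<open>l\<close> and \<open>C\<close> is
  the cellular basis. The coefficients of a linear combination are extensional functions on the
  index set, so that the basis property becomes bijectivity of \<open>cell_combination\<close>.
\<close>

definition cell_indices :: "'l set \<Rightarrow> ('l \<Rightarrow> 't set) \<Rightarrow> ('l \<times> 't \<times> 't) set" where
  "cell_indices \<Lambda> M = (SIGMA l:\<Lambda>. M l \<times> M l)"

definition cell_combination ::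
    "('a, 'c) ring_scheme \<Rightarrow> ('f::field \<Rightarrow> 'a) \<Rightarrow> ('l \<Rightarrow> 't \<Rightarrow> 't \<Rightarrow> 'a) \<Rightarrow> ('l \<times> 't \<times> 't) set
      \<Rightarrow> ('l \<times> 't \<times> 't \<Rightarrow> 'f) \<Rightarrow> 'a" where
  "cell_combination A \<iota> C I v =
     (\<Oplus>\<^bsub>A\<^esub>i\<in>I. \<iota> (v i) \<otimes>\<^bsub>A\<^esub> (case i of (l, s, t) \<Rightarrow> C l s t))"

definition cell_lower ::
    "('a, 'c) ring_scheme \<Rightarrow> ('f::field \<Rightarrow> 'a) \<Rightarrow> 'l set \<Rightarrow> ('l \<Rightarrow> 'l \<Rightarrow> bool) \<Rightarrow> ('l \<Rightarrow> 't set)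
      \<Rightarrow> ('l \<Rightarrow> 't \<Rightarrow> 't \<Rightarrow> 'a) \<Rightarrow> 'l \<Rightarrow> 'a set" where
  "cell_lower A \<iota> \<Lambda> prec M C l = (let I = cell_indices {\<mu>\<in>\<Lambda>. prec \<mu> l} M in
     cell_combination A \<iota> C I ` (I \<rightarrow>\<^sub>E UNIV))"

text \<open>
  \<open>a C\<^sub>s\<^sub>t \<equiv> \<Sum>\<^sub>s\<^sub>' \<rho>(s',s) C\<^sub>s\<^sub>'\<^sub>t\<close> modulo lower cells, with coefficients independent of \<open>t\<close>;
  the argument \<open>u\<close> is the column \<open>\<rho>(\<hyphen>,s)\<close>.
\<close>

definition cell_action ::
    "('a, 'c) ring_scheme \<Rightarrow> ('f::field \<Rightarrow> 'a) \<Rightarrow> 'l set \<Rightarrow> ('l \<Rightarrow> 'l \<Rightarrow> bool) \<Rightarrow> ('l \<Rightarrow> 't set)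
      \<Rightarrow> ('l \<Rightarrow> 't \<Rightarrow> 't \<Rightarrow> 'a) \<Rightarrow> 'l \<Rightarrow> 'a \<Rightarrow> 't \<Rightarrow> ('t \<Rightarrow> 'f) \<Rightarrow> bool" where
  "cell_action A \<iota> \<Lambda> prec M C l a s u \<longleftrightarrow> u \<in> M l \<rightarrow>\<^sub>E UNIV \<and>
     (\<forall>t\<in>M l. a \<otimes>\<^bsub>A\<^esub> C l s t \<ominus>\<^bsub>A\<^esub> (\<Oplus>\<^bsub>A\<^esub>s'\<in>M l. \<iota> (u s') \<otimes>\<^bsub>A\<^esub> C l s' t)
        \<in> cell_lower A \<iota> \<Lambda> prec M C l)"

locale cellular_algebra = ring A
  for A :: "('a, 'c) ring_scheme" (structure) +
  fixes \<iota> :: "'f::field \<Rightarrow> 'a" and \<Lambda> :: "'l set" and prec :: "'l \<Rightarrow> 'l \<Rightarrow> bool"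
    and M :: "'l \<Rightarrow> 't set" and C :: "'l \<Rightarrow> 't \<Rightarrow> 't \<Rightarrow> 'a" and star :: "'a \<Rightarrow> 'a"
  assumes scalar_closed: "\<iota> c \<in> carrier A"
    and scalar_one: "\<iota> 1 = \<one>"
    and scalar_add: "\<iota> (c + c') = \<iota> c \<oplus> \<iota> c'"
    and scalar_mult: "\<iota> (c * c') = \<iota> c \<otimes> \<iota> c'"
    and scalar_central: "a \<in> carrier A \<Longrightarrow> \<iota> c \<otimes> a = a \<otimes> \<iota> c"
    and finite_cells: "finite \<Lambda>"
    and cell_irrefl: "l \<in> \<Lambda> \<Longrightarrow> \<not> prec l l"
    and cell_trans: "\<lbrakk>l \<in> \<Lambda>; \<mu> \<in> \<Lambda>; \<nu> \<in> \<Lambda>; prec l \<mu>; prec \<mu> \<nu>\<rbrakk> \<Longrightarrow> prec l \<nu>"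
    and finite_index: "l \<in> \<Lambda> \<Longrightarrow> finite (M l)"
    and basis_closed: "\<lbrakk>l \<in> \<Lambda>; s \<in> M l; t \<in> M l\<rbrakk> \<Longrightarrow> C l s t \<in> carrier A"
    and basis: "bij_betw (cell_combination A \<iota> C (cell_indices \<Lambda> M))
      (cell_indices \<Lambda> M \<rightarrow>\<^sub>E UNIV) (carrier A)"
    and star_closed: "a \<in> carrier A \<Longrightarrow> star a \<in> carrier A"
    and star_add: "\<lbrakk>a \<in> carrier A; b \<in> carrier A\<rbrakk> \<Longrightarrow> star (a \<oplus> b) = star a \<oplus> star b"
    and star_mult: "\<lbrakk>a \<in> carrier A; b \<in> carrier A\<rbrakk> \<Longrightarrow> star (a \<otimes> b) = star b \<otimes> star a"
    and star_scalar: "star (\<iota> c) = \<iota> c"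
    and star_star: "a \<in> carrier A \<Longrightarrow> star (star a) = a"
    and star_basis: "\<lbrakk>l \<in> \<Lambda>; s \<in> M l; t \<in> M l\<rbrakk> \<Longrightarrow> star (C l s t) = C l t s"
    and action: "\<lbrakk>l \<in> \<Lambda>; a \<in> carrier A; s \<in> M l\<rbrakk> \<Longrightarrow> \<exists>u. cell_action A \<iota> \<Lambda> prec M C l a s u"

text \<open>The cell module of \<open>l\<close>: the vector space of functions on \<open>M l\<close>, i.e. with basis \<open>(C\<^sub>s)\<^sub>s\<close>.\<close>

definition cell_module ::
    "('a, 'c) ring_scheme \<Rightarrow> ('f::field \<Rightarrow> 'a) \<Rightarrow> 'l set \<Rightarrow> ('l \<Rightarrow> 'l \<Rightarrow> bool) \<Rightarrow> ('l \<Rightarrow> 't set)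
      \<Rightarrow> ('l \<Rightarrow> 't \<Rightarrow> 't \<Rightarrow> 'a) \<Rightarrow> 'l \<Rightarrow> ('a, 't \<Rightarrow> 'f) module" where
  "cell_module A \<iota> \<Lambda> prec M C l =
     \<lparr>carrier = M l \<rightarrow>\<^sub>E UNIV,
      mult = undefined, one = undefined,
      zero = (\<lambda>s\<in>M l. 0),
      add = (\<lambda>v w. \<lambda>s\<in>M l. v s + w s),
      smult = (\<lambda>a v. \<lambda>s'\<in>M l. \<Sum>s\<in>M l. (THE u. cell_action A \<iota> \<Lambda> prec M C l a s u) s' * v s)\<rparr>"


section \<open>Specht modules of the fixed subalgebra\<close>

definition isomorphic_up_to_twist ::
    "('a, 'c) ring_scheme \<Rightarrow> ('f::field \<Rightarrow> 'a) \<Rightarrow> ('a, 'm, 'd) module_scheme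
      \<Rightarrow> ('a, 'm, 'd) module_scheme \<Rightarrow> bool" where
  "isomorphic_up_to_twist R \<iota> M N \<longleftrightarrow>
     (\<exists>\<tau>\<in>ring_iso R R. (\<forall>c. \<tau> (\<iota> c) = \<iota> c) \<and> modules_isomorphic R M (twisted_module \<tau> N))"

text \<open>
  The list \<open>Ms\<close> is a decomposition of the restriction of \<open>M\<close> to \<open>R\<close> into a direct sum of
  \<open>R\<close>-modules pairwise isomorphic up to a twist of the action; its number of summands is the length
  of the list.
\<close>

definition twisted_decomposition ::
    "('a, 'c) ring_scheme \<Rightarrow> ('f::field \<Rightarrow> 'a) \<Rightarrow> ('a, 'k) module \<Rightarrow> ('a, 'm) module list \<Rightarrow> bool" where
  "twisted_decomposition R \<iota> M Ms \<longleftrightarrow>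
     (\<forall>N\<in>set Ms. left_module R N) \<and>
     (\<forall>N\<in>set Ms. \<forall>N'\<in>set Ms. isomorphic_up_to_twist R \<iota> N N') \<and>
     modules_isomorphic R M (module_direct_sum Ms)"


section \<open>Orbit lengths divide \<open>p\<close>\<close>

text \<open>Hence the natural-number quotients \<open>p div card (shift_orbit _ _)\<close> are exact.\<close>

lemma card_shift_orbit_dvd:
  assumes "p \<ge> 1" and fp: "(f ^^ p) x = x"
  shows "card (shift_orbit f x) dvd p"
proof -
  define m where "m = (LEAST m. m \<ge> 1 \<and> (f ^^ m) x = x)"
  have "m \<ge> 1 \<and> (f ^^ m) x = x"
    unfolding m_def by (rule LeastI[of _ p]) (use assms in simp)
  then have m: "m \<ge> 1" "(f ^^ m) x = x" by simp_all
  have least: "k = 0" if "(f ^^ k) x = x" "k < m" for k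
    using not_less_Least[of k "\<lambda>m. m \<ge> 1 \<and> (f ^^ m) x = x"] that unfolding m_def by force
  have red: "(f ^^ (k mod m)) x = (f ^^ k) x" for k
    by (rule funpow_mod_eq[OF m(2)])
  have ne: "(f ^^ i) x \<noteq> (f ^^ j) x" if "i < j" "j < m" for i j
  proof
    assume eq: "(f ^^ i) x = (f ^^ j) x"
    have "(f ^^ (m - j + i)) x = (f ^^ (m - j + j)) x"
      by (simp only: funpow_add comp_apply eq)
    then have "(f ^^ (m - j + i)) x = x" using that m(2) by simp
    moreover have "m - j + i < m" "m - j + i \<noteq> 0" using that by linarith+
    ultimately show False using least[of "m - j + i"] by simp
  qed
  have "inj_on (\<lambda>k. (f ^^ k) x) {..<m}"
    by (rule linorder_inj_onI) (use ne in auto)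
  moreover have "shift_orbit f x = (\<lambda>k. (f ^^ k) x) ` {..<m}"
  proof -
    have "(f ^^ k) x \<in> (\<lambda>k. (f ^^ k) x) ` {..<m}" for k
      using red[of k] m(1) by (intro image_eqI[of _ _ "k mod m"]) auto
    then show ?thesis by (auto simp: shift_orbit_def)
  qed
  ultimately have "card (shift_orbit f x) = m" by (simp add: card_image)
  moreover have "p mod m = 0" using least[of "p mod m"] red[of p] fp m(1) by simp
  ultimately show ?thesis by auto
qed

lemma card_orbit_multipartition_dvd:
  assumes "d \<ge> 1" "p \<ge> 1" "lam \<in> multipartitions (d * p) n"
  shows "card (shift_orbit (multipartition_shift d) lam) dvd p"
proof (rule card_shift_orbit_dvd)
  have len: "length lam = d * p" using assms(3) by (simp add: multipartitions_def)
  have rot: "multipartition_shift d xs = rotate (d * p - d) xs" if "length xs = d * p" for xs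
    using that assms(1,2) by (simp add: multipartition_shift_def rotate_drop_take)
  have it: "(multipartition_shift d ^^ k) lam = rotate (k * (d * p - d)) lam" for k
    by (induction k) (simp_all add: rot len rotate_rotate)
  have "p * (d * p - d) = d * p * (p - 1)" by (simp add: algebra_simps)
  then show "(multipartition_shift d ^^ p) lam = lam"
    unfolding it by (simp add: len rotate_id)
qed (rule assms)

lemma card_orbit_content_dvd:
  assumes "p \<ge> 1" "\<eta> \<ge> 1" "\<alpha> \<in> contents (\<eta> * p) \<kappa> r n"
  shows "card (shift_orbit (content_shift (\<eta> * p) \<eta>) \<alpha>) dvd p"
proof (rule card_shift_orbit_dvd)
  have "residue (\<eta> * p) \<kappa> \<gamma> < \<eta> * p" for \<gamma>
    using assms(1,2) by (auto simp: residue_def nat_less_iff split: prod.split)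
  moreover obtain lam where "\<alpha> = content (\<eta> * p) \<kappa> lam"
    using assms(3) by (auto simp: contents_def)
  ultimately have lt: "i < \<eta> * p" if "i \<in># \<alpha>" for i
    using that unfolding content_def
    by (cases "finite (young lam)") (auto simp: set_mset_sum)
  have it: "(content_shift (\<eta> * p) \<eta> ^^ k) \<alpha> = image_mset (\<lambda>i. (i + k * \<eta>) mod (\<eta> * p)) \<alpha>" for k
  proof (induction k)
    case 0
    then show ?case using lt by (simp cong: image_mset_cong)
  next
    case (Suc k)
    then show ?case
      by (simp add: content_shift_def multiset.map_comp comp_def mod_add_left_eq add.assoc)
        (simp add: add_ac)
  qed
  show "(content_shift (\<eta> * p) \<eta> ^^ p) \<alpha> = \<alpha>"
    unfolding it using lt by (simp add: mult.commute cong: image_mset_cong)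
qed (rule assms)

end

theory Submission
  imports Defs
begin

text \<open>
  The number of summands attached to \<open>\<lambda>\<close> is \<open>p\<close> divided by the orbit length of \<open>\<lambda>\<close>, so the claim is that
  the least orbit length among the multipartitions with content in the orbit of \<open>\<alpha>\<close> is the orbit
  length \<open>m\<close> of \<open>\<alpha>\<close>. Since taking contents commutes with the shifts, no such multipartition has a
  shorter orbit. What has to be shown is that some multipartition of content \<open>\<alpha>\<close> is fixed by the
  \<open>m\<close>-th power of the shift.

  That power is a shift of the same kind, with \<open>d\<close>, \<open>\<eta>\<close>, \<open>p\<close> replaced by \<open>md\<close>, \<open>m\<eta>\<close>, \<open>p/m\<close>
  (\<open>periodic_multicharge_multiple\<close>), so one may suppose that \<open>\<alpha>\<close> itself is shift-invariant. Write
  \<open>c\<^sub>i\<close> for the number of nodes of residue \<open>i\<close> and \<open>\<Lambda>\<^sub>i\<close> for the number of components of charge \<open>i\<close>.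
  Let \<open>A\<^sub>i\<close> and \<open>R\<^sub>i\<close> be the numbers of addable and of removable nodes of residue \<open>i\<close>. The argument
  rests on the identity \<open>A\<^sub>i - R\<^sub>i = \<Lambda>\<^sub>i - 2 c\<^sub>i + c\<^sub>i\<^sub>-\<^sub>1 + c\<^sub>i\<^sub>+\<^sub>1\<close> (\<open>addable_minus_removable\<close>), whose
  right-hand side is the pairing of the weight \<open>\<Lambda> - \<alpha>\<close> with the \<open>i\<close>-th coroot of affine \<open>sl\<^sub>e\<close>.

  If all pairings are nonnegative (\<open>stable_diagram_dominant\<close>), take a largest shift-invariant
  diagram whose content is at most \<open>\<alpha>\<close>. A residue that is still deficient has no addable node, as the
  whole shift orbit of such a node could be added. The identity then says that the deficiency \<open>g\<close>
  satisfies \<open>2 g\<^sub>i \<le> g\<^sub>i\<^sub>-\<^sub>1 + g\<^sub>i\<^sub>+\<^sub>1\<close> wherever \<open>g\<^sub>i > 0\<close>. If \<open>g\<close> is not zero, it is therefore equal to its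
  maximum all around the cycle \<open>\<int>/e\<int>\<close>, so no residue has an addable node, which is absurd.

  If some pairing is \<open>-k < 0\<close>, one applies the simple reflections at all residues in the shift orbit of
  \<open>i\<close>; they commute (\<open>stable_diagram_exists\<close>). Removing \<open>k\<close> removable nodes of each of these residues
  gives a smaller diagram with shift-invariant content. By induction that content is the content of a
  shift-invariant diagram; there the pairing is \<open>+k\<close>, so it has \<open>k\<close> addable nodes of residue \<open>i\<close>, and
  adding these with all their shifts restores \<open>\<alpha>\<close>.
\<close>

section \<open>Young diagrams\<close>

text \<open>
  Multipartitions are replaced by their diagrams: finite sets of nodes closed under moving up and left.
  Adding or removing nodes is then a set operation, and any set of addable or of removable nodes can be
  treated at once.
\<close>

definition diagram :: "nat \<Rightarrow> node set \<Rightarrow> bool" where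
  "diagram r D \<longleftrightarrow> finite D \<and> (\<forall>a b c. (a, b, c) \<in> D \<longrightarrow> c < r) \<and>
     (\<forall>a b c a' b'. (a, b, c) \<in> D \<and> a' \<le> a \<and> b' \<le> b \<longrightarrow> (a', b', c) \<in> D)"

definition addable :: "nat \<Rightarrow> node set \<Rightarrow> node set" where
  "addable r D = {(a, b, c). c < r \<and> (a, b, c) \<notin> D \<and>
     (a = 0 \<or> (a - 1, b, c) \<in> D) \<and> (b = 0 \<or> (a, b - 1, c) \<in> D)}"

definition removable :: "node set \<Rightarrow> node set" where
  "removable D = {(a, b, c). (a, b, c) \<in> D \<and> (Suc a, b, c) \<notin> D \<and> (a, Suc b, c) \<notin> D}"

lemma diagramD:
  assumes "diagram r D"
  shows "finite D" "(a, b, c) \<in> D \<Longrightarrow> c < r"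
    "(a, b, c) \<in> D \<Longrightarrow> a' \<le> a \<Longrightarrow> b' \<le> b \<Longrightarrow> (a', b', c) \<in> D"
  using assms unfolding diagram_def by blast+

lemma diagram_Suc:
  assumes "diagram r D"
  shows "(Suc a, b, c) \<in> D \<Longrightarrow> (a, b, c) \<in> D" "(a, Suc b, c) \<in> D \<Longrightarrow> (a, b, c) \<in> D"
  using diagramD(3)[OF assms] by (meson le_SucI order_refl)+

lemma diagramI:
  assumes "finite D" "\<And>a b c. (a, b, c) \<in> D \<Longrightarrow> c < r"
    and down: "\<And>a b c. (Suc a, b, c) \<in> D \<Longrightarrow> (a, b, c) \<in> D"
    and right: "\<And>a b c. (a, Suc b, c) \<in> D \<Longrightarrow> (a, b, c) \<in> D"
  shows "diagram r D"
proof -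
  have 1: "(a + k, b, c) \<in> D \<Longrightarrow> (a, b, c) \<in> D" for a b c k
    by (induction k) (use down in auto)
  have 2: "(a, b + k, c) \<in> D \<Longrightarrow> (a, b, c) \<in> D" for a b c k
    by (induction k) (use right in auto)
  have "(a', b', c) \<in> D" if "(a, b, c) \<in> D" "a' \<le> a" "b' \<le> b" for a b c a' b'
    using that 1[of a' "a - a'" b c] 2[of a' b' "b - b'" c] by simp
  then show ?thesis using assms(1,2) unfolding diagram_def by blast
qed

lemma diagram_add:
  assumes "diagram r D" "finite U" "U \<subseteq> addable r D"
  shows "diagram r (D \<union> U)"
proof (rule diagramI)
  show "finite (D \<union> U)" using assms diagramD(1) by blast
  show "c < r" if "(a, b, c) \<in> D \<union> U" for a b c
    using that assms diagramD(2)[OF assms(1)] unfolding addable_def by blast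
  show "(a, b, c) \<in> D \<union> U" if "(Suc a, b, c) \<in> D \<union> U" for a b c
    using that assms(3) diagram_Suc(1)[OF assms(1)] unfolding addable_def by fastforce
  show "(a, b, c) \<in> D \<union> U" if "(a, Suc b, c) \<in> D \<union> U" for a b c
    using that assms(3) diagram_Suc(2)[OF assms(1)] unfolding addable_def by fastforce
qed

lemma diagram_remove:
  assumes "diagram r D" "U \<subseteq> removable D"
  shows "diagram r (D - U)"
proof (rule diagramI)
  show "finite (D - U)" using assms diagramD(1) by blast
  show "c < r" if "(a, b, c) \<in> D - U" for a b c
    using that diagramD(2)[OF assms(1)] by blast
  show "(a, b, c) \<in> D - U" if "(Suc a, b, c) \<in> D - U" for a b c
    using that assms(2) diagram_Suc(1)[OF assms(1)] unfolding removable_def by blast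
  show "(a, b, c) \<in> D - U" if "(a, Suc b, c) \<in> D - U" for a b c
    using that assms(2) diagram_Suc(2)[OF assms(1)] unfolding removable_def by blast
qed

lemma finite_addable:
  assumes "diagram r D"
  shows "finite (addable r D)"
proof (rule finite_subset)
  let ?f = "\<lambda>(a, b, c). (Suc a, b, c)" and ?g = "\<lambda>(a, b, c). (a, Suc b, c)"
  show "addable r D \<subseteq> ?f ` D \<union> ?g ` D \<union> (\<lambda>c. (0, 0, c)) ` {..<r}"
  proof
    fix x assume "x \<in> addable r D"
    then obtain a b c where x: "x = (a, b, c)" "c < r" "a = 0 \<or> (a - 1, b, c) \<in> D"
      "b = 0 \<or> (a, b - 1, c) \<in> D" unfolding addable_def by blast
    consider (1) "a \<noteq> 0" "(a - 1, b, c) \<in> D" | (2) "b \<noteq> 0" "(a, b - 1, c) \<in> D"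
      | (3) "a = 0" "b = 0" using x by blast
    then show "x \<in> ?f ` D \<union> ?g ` D \<union> (\<lambda>c. (0, 0, c)) ` {..<r}"
    proof cases
      case 1 then have "x \<in> ?f ` D" using x(1) by (intro image_eqI[of _ _ "(a - 1, b, c)"]) auto
      then show ?thesis by blast
    next
      case 2 then have "x \<in> ?g ` D" using x(1) by (intro image_eqI[of _ _ "(a, b - 1, c)"]) auto
      then show ?thesis by blast
    next
      case 3 then show ?thesis using x by auto
    qed
  qed
qed (use diagramD(1)[OF assms] in auto)

text \<open>The first row of the first component can always be prolonged.\<close>

lemma addable_nonempty:
  assumes "diagram r D" "0 < r"
  shows "addable r D \<noteq> {}"
proof -
  have "finite ((\<lambda>(a, b, c). b) ` D)" using diagramD(1)[OF assms(1)] by simp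
  then obtain b where "b \<notin> (\<lambda>(a, b, c). b) ` D" using ex_new_if_finite infinite_UNIV_nat by blast
  then have ex: "(0, b, 0) \<notin> D" by force
  define b0 where "b0 = (LEAST b. (0, b, 0) \<notin> D)"
  have "(0, b0, 0) \<notin> D" unfolding b0_def using ex by (rule LeastI)
  moreover have "(0, b0 - 1, 0) \<in> D" if "b0 \<noteq> 0"
    using not_less_Least[of "b0 - 1" "\<lambda>b. (0, b, 0) \<notin> D"] that unfolding b0_def by fastforce
  ultimately have "(0, b0, 0) \<in> addable r D" using assms(2) unfolding addable_def by blast
  then show ?thesis by blast
qed

lemma card_filter_split:
  "finite S \<Longrightarrow> card S = card {x \<in> S. P x} + card {x \<in> S. \<not> P x}"
  by (subst card_Un_disjoint[symmetric]) (auto intro: arg_cong[where f = card])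

section \<open>Addable and removable nodes of a given residue\<close>

text \<open>
  Residues are taken to be arbitrary integers, read modulo \<open>e\<close>, so that neighbouring residues are
  \<open>j - 1\<close> and \<open>j + 1\<close> without reduction.
\<close>

locale multicharge =
  fixes e r :: nat and \<kappa> :: "nat \<Rightarrow> nat"
begin

definition has_residue :: "int \<Rightarrow> node \<Rightarrow> bool" where
  "has_residue j = (\<lambda>(a, b, c). int e dvd int b - int a + int (\<kappa> c) - j)"

definition residue_count :: "node set \<Rightarrow> int \<Rightarrow> int" where
  "residue_count D j = int (card {x \<in> D. has_residue j x})"

definition charge_count :: "int \<Rightarrow> int" where
  "charge_count j = int (card {c. c < r \<and> int e dvd int (\<kappa> c) - j})"

lemma has_residue_Suc:
  "has_residue j (Suc a, b, c) \<longleftrightarrow> has_residue (j + 1) (a, b, c)"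
  "has_residue j (a, Suc b, c) \<longleftrightarrow> has_residue (j - 1) (a, b, c)"
  by (simp_all add: has_residue_def algebra_simps)

lemma has_residue_cong: "int e dvd i - j \<Longrightarrow> has_residue i x \<longleftrightarrow> has_residue j x"
proof -
  assume *: "int e dvd i - j"
  obtain a b c where x: "x = (a, b, c)" by (cases x)
  have "int b - int a + int (\<kappa> c) - j = (int b - int a + int (\<kappa> c) - i) + (i - j)" by simp
  then show ?thesis using * unfolding has_residue_def x by (metis case_prod_conv dvd_add_left_iff)
qed

lemma has_residue_unique: "has_residue i x \<Longrightarrow> has_residue j x \<Longrightarrow> int e dvd i - j"
proof -
  assume *: "has_residue i x" "has_residue j x"
  obtain a b c where x: "x = (a, b, c)" by (cases x)
  have "i - j = (int b - int a + int (\<kappa> c) - j) - (int b - int a + int (\<kappa> c) - i)" by simp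
  then show ?thesis using * unfolding has_residue_def x by (metis case_prod_conv dvd_diff)
qed

lemma residue_count_cong: "int e dvd i - j \<Longrightarrow> residue_count D i = residue_count D j"
  unfolding residue_count_def using has_residue_cong by presburger

text \<open>
  Both differences of neighbouring counts are computed by moving nodes along rows: the nodes of residue
  \<open>j\<close> that are not the last of their row correspond to the nodes of residue \<open>j + 1\<close> outside the first
  column. So \<open>c\<^sub>j - c\<^sub>j\<^sub>+\<^sub>1\<close> compares the ends of rows (\<open>E\<close>) with the first column (\<open>F\<close>). A row end of
  residue \<open>i\<close> is either removable or has a row end of residue \<open>i - 1\<close> below it, and a row end of residue
  \<open>i - 1\<close> not reached in this way has an addable node of residue \<open>i\<close> on its right. The first column is
  treated alike, and its top nodes account for the charges.
\<close>

lemma addable_minus_removable: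
  assumes D: "diagram r D"
  shows "residue_count (addable r D) i - residue_count (removable D) i =
    charge_count i - 2 * residue_count D i + residue_count D (i - 1) + residue_count D (i + 1)"
proof -
  note dS = diagram_Suc[OF D] and fD = diagramD(1)[OF D]
  define E where "E j = {(a, b, c). (a, b, c) \<in> D \<and> has_residue j (a, b, c) \<and> (a, Suc b, c) \<notin> D}" for j
  define F where "F j = {(a, b, c). (a, b, c) \<in> D \<and> has_residue j (a, b, c) \<and> b = 0}" for j
  define A where "A = {x \<in> addable r D. has_residue i x}"
  define R where "R = {x \<in> removable D. has_residue i x}"
  let ?down = "\<lambda>(a, b, c). (Suc a, b, c) :: node" and ?up = "\<lambda>(a, b, c). (a - 1, b, c) :: node"
  let ?right = "\<lambda>(a, b, c). (a, Suc b, c) :: node" and ?left = "\<lambda>(a, b, c). (a, b - 1, c) :: node"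
  let ?row = "\<lambda>(a, b, c). a :: nat" and ?col = "\<lambda>(a, b, c). b :: nat"
  have fin: "finite (E j)" "finite (F j)" "finite {x \<in> D. has_residue j x}" "finite A" for j
    using fD finite_addable[OF D] unfolding E_def F_def A_def by (auto elim: rev_finite_subset)
  have split: "int (card S) = int (card {x \<in> S. P x}) + int (card {x \<in> S. \<not> P x})"
    if "finite S" for S :: "node set" and P
    using card_filter_split[OF that, of P] by simp
  have rows: "residue_count D j - residue_count D (j + 1) = int (card (E j)) - int (card (F (j + 1)))" for j
  proof -
    have "bij_betw ?right {x \<in> {x \<in> D. has_residue j x}. ?right x \<in> D}
        {x \<in> {x \<in> D. has_residue (j + 1) x}. \<not> ?col x = 0}"
      by (rule bij_betw_byWitness[where f' = ?left])
        (auto simp: has_residue_Suc gr0_conv_Suc intro: dS)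
    from bij_betw_same_card[OF this]
    show ?thesis
      using split[OF fin(3), of j "\<lambda>x. ?right x \<in> D"] split[OF fin(3), of "j + 1" "\<lambda>x. ?col x = 0"]
      unfolding residue_count_def E_def F_def
      by (simp add: case_prod_unfold conj_assoc cong: conj_cong)
  qed
  have rims: "int (card (E i)) - int (card R) =
      int (card (E (i - 1))) - int (card {x \<in> A. ?col x \<noteq> 0})"
  proof -
    let ?Q = "\<lambda>(a, b, c). \<exists>a'. a = Suc a' \<and> (a', Suc b, c) \<notin> D"
    have b1: "bij_betw ?down {x \<in> E i. ?down x \<in> D} {x \<in> E (i - 1). ?Q x}"
      by (rule bij_betw_byWitness[where f' = ?up])
        (auto simp: E_def has_residue_Suc gr0_conv_Suc dest: dS)
    have b2: "bij_betw ?right {x \<in> E (i - 1). \<not> ?Q x} {x \<in> A. ?col x \<noteq> 0}"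
      by (rule bij_betw_byWitness[where f' = ?left])
        (auto simp: E_def A_def addable_def has_residue_Suc gr0_conv_Suc diagramD(2)[OF D],
          metis diff_Suc_Suc diff_zero not0_implies_Suc)
    have R_eq: "{x \<in> E i. \<not> ?down x \<in> D} = R"
      by (auto simp: E_def R_def removable_def)
    show ?thesis
      using split[OF fin(1), of i "\<lambda>x. ?down x \<in> D"] split[OF fin(1), of "i - 1" ?Q]
        bij_betw_same_card[OF b1] bij_betw_same_card[OF b2] unfolding R_eq by linarith
  qed
  have column: "int (card (F (i + 1))) - int (card {x \<in> {x \<in> A. ?col x = 0}. ?row x \<noteq> 0}) =
      int (card (F i)) - int (card {x \<in> F i. ?row x = 0})"
  proof -
    have b1: "bij_betw ?down {x \<in> F (i + 1). ?down x \<in> D} {x \<in> F i. ?row x \<noteq> 0}"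
      by (rule bij_betw_byWitness[where f' = ?up])
        (auto simp: F_def has_residue_Suc gr0_conv_Suc dest: dS)
    have b2: "bij_betw ?down {x \<in> F (i + 1). \<not> ?down x \<in> D} {x \<in> {x \<in> A. ?col x = 0}. ?row x \<noteq> 0}"
      by (rule bij_betw_byWitness[where f' = ?up])
        (auto simp: F_def A_def addable_def has_residue_Suc gr0_conv_Suc diagramD(2)[OF D])
    show ?thesis
      using split[OF fin(2), of "i + 1" "\<lambda>x. ?down x \<in> D"] split[OF fin(2), of i "\<lambda>x. ?row x = 0"]
        bij_betw_same_card[OF b1] bij_betw_same_card[OF b2] by linarith
  qed
  have corner: "int (card {x \<in> F i. ?row x = 0}) + int (card {x \<in> {x \<in> A. ?col x = 0}. ?row x = 0}) =
      charge_count i"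
  proof -
    let ?C = "{c. c < r \<and> int e dvd int (\<kappa> c) - i}"
    have b1: "bij_betw (\<lambda>c. (0, 0, c)) {c \<in> ?C. (0, 0, c) \<in> D} {x \<in> F i. ?row x = 0}"
      by (rule bij_betw_byWitness[where f' = "\<lambda>(a, b, c). c"])
        (auto simp: F_def has_residue_def diagramD(2)[OF D])
    have b2: "bij_betw (\<lambda>c. (0, 0, c)) {c \<in> ?C. \<not> (0, 0, c) \<in> D} {x \<in> {x \<in> A. ?col x = 0}. ?row x = 0}"
      by (rule bij_betw_byWitness[where f' = "\<lambda>(a, b, c). c"])
        (auto simp: A_def addable_def has_residue_def)
    have "finite ?C" by simp
    from card_filter_split[OF this, of "\<lambda>c. (0, 0, c) \<in> D"] show ?thesis
      using bij_betw_same_card[OF b1] bij_betw_same_card[OF b2]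
      unfolding charge_count_def by linarith
  qed
  have "int (card A) = int (card {x \<in> A. ?col x \<noteq> 0}) + int (card {x \<in> {x \<in> A. ?col x = 0}. ?row x \<noteq> 0})
      + int (card {x \<in> {x \<in> A. ?col x = 0}. ?row x = 0})"
    using split[OF fin(4), of "\<lambda>x. ?col x = 0"]
      split[of "{x \<in> A. ?col x = 0}" "\<lambda>x. ?row x = 0"] fin(4) by simp
  then show ?thesis
    using rows[of i] rows[of "i - 1"] rims column corner
    unfolding residue_count_def[of "addable r D"] residue_count_def[of "removable D"]
      A_def[symmetric] R_def[symmetric] by simp
qed

lemma residue_count_Un:
  assumes "finite D" "finite U" "D \<inter> U = {}"
  shows "residue_count (D \<union> U) j = residue_count D j + residue_count U j"
proof -
  have "{x \<in> D \<union> U. has_residue j x} = {x \<in> D. has_residue j x} \<union> {x \<in> U. has_residue j x}" by blast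
  moreover have "card ({x \<in> D. has_residue j x} \<union> {x \<in> U. has_residue j x}) =
      card {x \<in> D. has_residue j x} + card {x \<in> U. has_residue j x}"
    using assms by (intro card_Un_disjoint) auto
  ultimately show ?thesis unfolding residue_count_def by simp
qed


lemma residue_count_empty [simp]: "residue_count {} j = 0"
  by (simp add: residue_count_def)

lemma residue_count_nonneg: "0 \<le> residue_count D j"
  by (simp add: residue_count_def)

text \<open>The charges are the residues of the corner nodes, which turns facts on node sets into facts on charges.\<close>

lemma charge_count_eq: "charge_count j = residue_count ({0} \<times> {0} \<times> {..<r}) j"
proof -
  have "bij_betw (\<lambda>c. (0, 0, c)) {c. c < r \<and> int e dvd int (\<kappa> c) - j}
      {x \<in> {0} \<times> {0} \<times> {..<r}. has_residue j x}"
    by (rule bij_betw_byWitness[where f' = "\<lambda>(a, b, c). c"]) (auto simp: has_residue_def)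
  from bij_betw_same_card[OF this] show ?thesis
    unfolding charge_count_def residue_count_def by simp
qed

lemma card_le_sum_residue_count:
  assumes "finite D" "0 < e"
  shows "int (card D) \<le> (\<Sum>j\<in>{0..<int e}. residue_count D j)"
proof -
  have "D \<subseteq> (\<Union>j\<in>{0..<int e}. {x \<in> D. has_residue j x})"
  proof
    fix x assume "x \<in> D"
    obtain a b c where x: "x = (a, b, c)" by (cases x)
    let ?j = "(int b - int a + int (\<kappa> c)) mod int e"
    have "has_residue ?j x" unfolding has_residue_def x by (simp add: minus_mod_eq_mult_div)
    then show "x \<in> (\<Union>j\<in>{0..<int e}. {x \<in> D. has_residue j x})"
      using \<open>x \<in> D\<close> assms(2) by auto
  qed
  then have "card D \<le> card (\<Union>j\<in>{0..<int e}. {x \<in> D. has_residue j x})"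
    by (rule card_mono[rotated]) (use assms in auto)
  also have "\<dots> \<le> (\<Sum>j\<in>{0..<int e}. card {x \<in> D. has_residue j x})"
    by (rule card_UN_le) simp
  finally have "int (card D) \<le> int (\<Sum>j\<in>{0..<int e}. card {x \<in> D. has_residue j x})"
    by (simp only: of_nat_le_iff)
  then show ?thesis by (simp only: of_nat_sum residue_count_def)
qed

end

lemma periodic_int:
  fixes f :: "int \<Rightarrow> 'x"
  assumes "\<And>j. f (j + h) = f j" "h dvd i - j"
  shows "f i = f j"
proof -
  obtain k where k: "i = j + k * h" using assms(2) by (metis add.commute diff_add_cancel dvdE mult.commute)
  have "f (j + k * h) = f j"
  proof (induction k rule: int_induct[where k = 0])
    case (step1 k)
    then show ?case using assms(1)[of "j + k * h"] by (simp add: algebra_simps)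
  next
    case (step2 k)
    then show ?case using assms(1)[of "j + (k - 1) * h"] by (simp add: algebra_simps)
  qed simp
  then show ?thesis using k by simp
qed

section \<open>Shift-invariant diagrams\<close>

text \<open>
  Moving by \<open>\<delta>\<close> components raises the charge by \<open>h\<close>; \<open>p\<close> such moves are the identity. For a
  divisor \<open>m\<close> of \<open>p\<close>, the \<open>m\<close>-th power of such a shift is of the same kind.
\<close>

locale periodic_multicharge = multicharge +
  fixes \<delta> h p :: nat
  assumes e_eq: "e = h * p" and r_eq: "r = \<delta> * p"
    and pos: "0 < h" "0 < \<delta>" "0 < p"
    and charge_shift: "c < r \<Longrightarrow> int e dvd int (\<kappa> ((c + \<delta>) mod r)) - int (\<kappa> c) - int h"
begin

definition shift :: "node \<Rightarrow> node" where
  "shift = (\<lambda>(a, b, c). (a, b, (c + \<delta>) mod r))"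

definition stable :: "node set \<Rightarrow> bool" where
  "stable D \<longleftrightarrow> (\<forall>x\<in>D. shift x \<in> D)"

lemma r_pos: "0 < r" and e_pos: "0 < e"
  using pos e_eq r_eq by simp_all

lemma shift_pow: "c < r \<Longrightarrow> (shift ^^ k) (a, b, c) = (a, b, (c + k * \<delta>) mod r)"
  by (induction k) (simp_all add: shift_def mod_simps ac_simps)

lemma shift_period: "c < r \<Longrightarrow> (shift ^^ p) (a, b, c) = (a, b, c)"
  using shift_pow[of c p a b] by (simp add: r_eq[symmetric] mult.commute[of p])

lemma has_residue_shift:
  "c < r \<Longrightarrow> has_residue (j + int h) (shift (a, b, c)) \<longleftrightarrow> has_residue j (a, b, c)"
proof -
  assume c: "c < r"
  have "int b - int a + int (\<kappa> ((c + \<delta>) mod r)) - (j + int h) =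
    (int b - int a + int (\<kappa> c) - j) + (int (\<kappa> ((c + \<delta>) mod r)) - int (\<kappa> c) - int h)" by simp
  then show ?thesis using charge_shift[OF c] unfolding has_residue_def shift_def
    by (metis case_prod_conv dvd_add_left_iff)
qed

lemma has_residue_shift_pow:
  "c < r \<Longrightarrow> has_residue (j + int k * int h) ((shift ^^ k) (a, b, c)) \<longleftrightarrow> has_residue j (a, b, c)"
proof (induction k)
  case (Suc k)
  have "j + int (Suc k) * int h = j + int k * int h + int h" by (simp add: algebra_simps)
  then show ?case
    using Suc has_residue_shift[of "(c + k * \<delta>) mod r" "j + int k * int h" a b]
    by (simp add: shift_pow r_pos add.assoc)
qed simp

lemma stable_pow: "stable D \<Longrightarrow> x \<in> D \<Longrightarrow> (shift ^^ k) x \<in> D"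
  by (induction k) (auto simp: stable_def)

lemma shift_pow_pred: "c < r \<Longrightarrow> (shift ^^ (p - 1)) (shift (a, b, c)) = (a, b, c)"
  "c < r \<Longrightarrow> shift ((shift ^^ (p - 1)) (a, b, c)) = (a, b, c)"
proof -
  assume c: "c < r"
  have "Suc (p - 1) = p" using pos by simp
  then show "(shift ^^ (p - 1)) (shift (a, b, c)) = (a, b, c)"
    "shift ((shift ^^ (p - 1)) (a, b, c)) = (a, b, c)"
    using shift_period[OF c, of a b] by (metis funpow_Suc_right comp_apply, metis funpow.simps(2) comp_apply)
qed

lemma stable_shift_iff: "stable D \<Longrightarrow> c < r \<Longrightarrow> (a, b, (c + \<delta>) mod r) \<in> D \<longleftrightarrow> (a, b, c) \<in> D"
  using stable_pow[of D "shift (a, b, c)" "p - 1"] shift_pow_pred(1)[of c a b]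
  by (auto simp: stable_def shift_def)

lemma stable_addable: "stable D \<Longrightarrow> stable (addable r D)"
  unfolding stable_def[of "addable r D"]
  using r_pos by (auto simp: addable_def shift_def stable_shift_iff)

lemma residue_count_stable:
  assumes "stable D" and D: "\<And>a b c. (a, b, c) \<in> D \<Longrightarrow> c < r"
  shows "residue_count D (j + int h) = residue_count D j"
proof -
  have "bij_betw shift {x \<in> D. has_residue j x} {x \<in> D. has_residue (j + int h) x}"
  proof (rule bij_betw_byWitness[where f' = "shift ^^ (p - 1)"])
    show "\<forall>x\<in>{x \<in> D. has_residue j x}. (shift ^^ (p - 1)) (shift x) = x"
      using D shift_pow_pred(1) by auto
    show "\<forall>x\<in>{x \<in> D. has_residue (j + int h) x}. shift ((shift ^^ (p - 1)) x) = x"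
      using D shift_pow_pred(2) by auto
    show "shift ` {x \<in> D. has_residue j x} \<subseteq> {x \<in> D. has_residue (j + int h) x}"
      using D has_residue_shift assms(1) unfolding stable_def by auto
    show "(shift ^^ (p - 1)) ` {x \<in> D. has_residue (j + int h) x} \<subseteq> {x \<in> D. has_residue j x}"
    proof (rule image_subsetI)
      fix x assume "x \<in> {x \<in> D. has_residue (j + int h) x}"
      moreover obtain a b c where xabc: "x = (a, b, c)" by (cases x)
      ultimately have x: "(a, b, c) \<in> D" "has_residue (j + int h) (a, b, c)" by simp_all
      obtain a' b' c' where y: "(shift ^^ (p - 1)) (a, b, c) = (a', b', c')"
        using prod_cases3 by blast
      have "(a', b', c') \<in> D" using stable_pow[OF assms(1) x(1), of "p - 1"] y by simp
      moreover have "shift (a', b', c') = (a, b, c)" using shift_pow_pred(2)[OF D[OF x(1)]] y by metis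
      ultimately show "(shift ^^ (p - 1)) x \<in> {x \<in> D. has_residue j x}"
        unfolding xabc y using x(2) has_residue_shift[of c' j a' b'] D by auto
    qed
  qed
  from bij_betw_same_card[OF this] show ?thesis unfolding residue_count_def by simp
qed

lemma charge_count_periodic: "charge_count (j + int h) = charge_count j"
  unfolding charge_count_eq
  by (rule residue_count_stable) (auto simp: stable_def shift_def r_pos)

text \<open>
  As \<open>e = h p\<close>, the residues \<open>i, i + h, \<dots>, i + (p - 1) h\<close> are pairwise incongruent modulo \<open>e\<close> and
  exhaust the class of \<open>i\<close> modulo \<open>h\<close>. Hence a union of layers of these residues meets each
  residue in that class in exactly one layer.
\<close>

lemma residue_count_layers:
  assumes X: "\<And>k. k < p \<Longrightarrow> X k \<subseteq> {x. has_residue (i + int k * int h) x} \<and> card (X k) = m"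
  shows "residue_count (\<Union>k<p. X k) j = (if int h dvd j - i then int m else 0)"
proof (cases "int h dvd j - i")
  case True
  then obtain t where t: "j - i = int h * t" by (rule dvdE)
  define k where "k = nat (t mod int p)"
  have k: "k < p" "int k = t mod int p" using pos by (simp_all add: k_def nat_less_iff)
  have "j - (i + int k * int h) = int h * (t - t mod int p)" using t k by (simp add: algebra_simps)
  also have "\<dots> = int e * (t div int p)" by (simp add: e_eq minus_mod_eq_mult_div)
  finally have jk: "int e dvd j - (i + int k * int h)" by simp
  have "{x \<in> (\<Union>k<p. X k). has_residue j x} = X k"
  proof (intro equalityI subsetI)
    fix x assume "x \<in> X k"
    then show "x \<in> {x \<in> (\<Union>k<p. X k). has_residue j x}"
      using X[OF k(1)] has_residue_cong[OF jk] k(1) by blast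
  next
    fix x assume "x \<in> {x \<in> (\<Union>k<p. X k). has_residue j x}"
    then obtain l where l: "l < p" "x \<in> X l" "has_residue j x" by blast
    then have "has_residue (i + int l * int h) x" "has_residue (i + int k * int h) x"
      using X has_residue_cong[OF jk] by blast+
    then have "int e dvd (i + int l * int h) - (i + int k * int h)" by (rule has_residue_unique)
    moreover have "(i + int l * int h) - (i + int k * int h) = int h * (int l - int k)"
      by (simp add: algebra_simps)
    ultimately have "int p dvd int l - int k" using pos by (simp add: e_eq)
    then have "l = k" using l(1) k(1) by (metis mod_eq_dvd_iff mod_less of_nat_eq_iff zmod_int)
    then show "x \<in> X k" using l(2) by simp
  qed
  then show ?thesis using True X[OF k(1)] unfolding residue_count_def by simp
next
  case False
  have "{x \<in> (\<Union>k<p. X k). has_residue j x} = {}"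
  proof (rule ccontr)
    assume "\<not> ?thesis"
    then obtain x k where "k < p" "x \<in> X k" "has_residue j x" by blast
    then have "int e dvd j - (i + int k * int h)" using X has_residue_unique by blast
    then have "int h dvd j - (i + int k * int h)" by (rule dvd_trans[rotated]) (simp add: e_eq)
    then have "int h dvd (j - (i + int k * int h)) + int k * int h" by (rule dvd_add) simp
    then show False using False by simp
  qed
  then show ?thesis using False unfolding residue_count_def by (simp only: card.empty if_False of_nat_0)
qed

text \<open>
  Shifts of an addable node of an invariant diagram are addable, and addable nodes do not obstruct
  each other, so whole orbits can be added.
\<close>

lemma add_shift_orbits:
  assumes D: "diagram r D" "stable D" and X: "X \<subseteq> addable r D" "\<And>x. x \<in> X \<Longrightarrow> has_residue i x"
  obtains D' where "diagram r D'" "stable D'" "D \<union> X \<subseteq> D'"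
    "\<And>j. residue_count D' j = residue_count D j + (if int h dvd j - i then int (card X) else 0)"
proof -
  define Y where "Y k = (shift ^^ k) ` X" for k
  define U where "U = (\<Union>k<p. Y k)"
  have Xr: "c < r" if "(a, b, c) \<in> X" for a b c using that X(1) unfolding addable_def by blast
  have fX: "finite X" using X(1) finite_addable[OF D(1)] finite_subset by blast
  have UA: "U \<subseteq> addable r D"
    using stable_pow[OF stable_addable[OF D(2)]] X(1) unfolding U_def Y_def by blast
  have fU: "finite U" using fX unfolding U_def Y_def by simp
  have "inj_on (shift ^^ k) X" for k
  proof (rule inj_onI)
    fix x y assume xy: "x \<in> X" "y \<in> X" "(shift ^^ k) x = (shift ^^ k) y"
    have inv: "(shift ^^ (k * p)) z = z" if "z \<in> X" for z
    proof -
      obtain a b c where z: "z = (a, b, c)" by (cases z)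
      have c: "c < r" using Xr that unfolding z by blast
      have "k * p * \<delta> = k * r" by (simp add: r_eq)
      then have "(shift ^^ (k * p)) (a, b, c) = (a, b, (c + k * r) mod r)"
        using shift_pow[OF c, of "k * p" a b] by (simp only:)
      then show ?thesis using c unfolding z by simp
    qed
    have "k * p = k * (p - 1) + k" using pos by (cases p) simp_all
    then have "(shift ^^ (k * p)) x = (shift ^^ (k * p)) y"
      using xy(3) by (simp only: funpow_add comp_apply)
    then show "x = y" using inv xy by simp
  qed
  then have "card (Y k) = card X" for k unfolding Y_def by (simp add: card_image)
  moreover have "Y k \<subseteq> {x. has_residue (i + int k * int h) x}" for k
    unfolding Y_def
  proof (rule image_subsetI)
    fix x assume x: "x \<in> X"
    obtain a b c where abc: "x = (a, b, c)" by (cases x)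
    show "(shift ^^ k) x \<in> {x. has_residue (i + int k * int h) x}"
      using X(2)[OF x] x Xr has_residue_shift_pow unfolding abc by blast
  qed
  ultimately have cU: "residue_count U j = (if int h dvd j - i then int (card X) else 0)" for j
    unfolding U_def by (intro residue_count_layers) blast
  show thesis
  proof
    show "diagram r (D \<union> U)" using diagram_add[OF D(1) fU UA] .
    have "shift x \<in> U" if xU: "x \<in> U" for x
    proof -
      obtain k y where ky: "k < p" "y \<in> X" "x = (shift ^^ k) y" using xU unfolding U_def Y_def by blast
      then have sx: "shift x = (shift ^^ (Suc k)) y" by simp
      show ?thesis
      proof (cases "Suc k < p")
        case True
        then show ?thesis using sx ky(2) unfolding U_def Y_def by blast
      next
        case False
        then have "Suc k = p" using ky(1) by simp
        then have "shift x = (shift ^^ 0) y" using sx shift_period Xr ky(2) by (cases y) simp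
        then show ?thesis using ky(2) pos(3) unfolding U_def Y_def by blast
      qed
    qed
    then show "stable (D \<union> U)" using D(2) unfolding stable_def by blast
    have "X = Y 0" by (simp add: Y_def)
    then show "D \<union> X \<subseteq> D \<union> U" using pos(3) unfolding U_def by blast
    have "D \<inter> U = {}" using UA unfolding addable_def by blast
    then show "residue_count (D \<union> U) j = residue_count D j + (if int h dvd j - i then int (card X) else 0)" for j
      using residue_count_Un[OF diagramD(1)[OF D(1)] fU] cU by simp
  qed
qed

text \<open>
  The case of a dominant weight. The maximum principle for the deficiency \<open>g\<close> replaces the usual
  appeal to the affine Cartan matrix being positive semidefinite.
\<close>

lemma stable_diagram_dominant:
  assumes D0: "diagram r D0" and per: "\<And>j. residue_count D0 (j + int h) = residue_count D0 j"
    and dom: "\<And>i. 0 \<le> charge_count i - 2 * residue_count D0 i + residue_count D0 (i - 1)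
                + residue_count D0 (i + 1)"
  shows "\<exists>D. diagram r D \<and> stable D \<and> residue_count D = residue_count D0"
proof -
  \<comment> \<open>a largest invariant diagram of content at most that of \<open>D0\<close>, and its deficiency \<open>g\<close>\<close>
  define ok where "ok D \<longleftrightarrow> diagram r D \<and> stable D \<and> (\<forall>j. residue_count D j \<le> residue_count D0 j)" for D
  have "ok {}" unfolding ok_def by (auto simp: diagram_def stable_def residue_count_nonneg)
  moreover have "card D \<le> nat (\<Sum>j\<in>{0..<int e}. residue_count D0 j)" if "ok D" for D
  proof -
    have "int (card D) \<le> (\<Sum>j\<in>{0..<int e}. residue_count D j)"
      using that card_le_sum_residue_count e_pos diagramD(1) unfolding ok_def by blast
    also have "\<dots> \<le> (\<Sum>j\<in>{0..<int e}. residue_count D0 j)"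
      by (rule sum_mono) (use that in \<open>simp add: ok_def\<close>)
    finally show ?thesis by simp
  qed
  ultimately have "\<exists>D. ok D \<and> (\<forall>D'. ok D' \<longrightarrow> card D' \<le> card D)"
    by (intro ex_has_greatest_nat[where b = "Suc (nat (\<Sum>j\<in>{0..<int e}. residue_count D0 j))"])
      (auto simp: less_Suc_eq_le)
  then obtain D where okD: "ok D" and max: "\<And>D'. ok D' \<Longrightarrow> card D' \<le> card D" by blast
  have D: "diagram r D" "stable D" using okD unfolding ok_def by blast+
  define g where "g j = residue_count D0 j - residue_count D j" for j
  have g0: "0 \<le> g j" for j using okD unfolding ok_def g_def by simp
  have gh: "g (j + int h) = g j" for j
    unfolding g_def using per residue_count_stable[OF D(2) diagramD(2)[OF D(1)]] by simp
  \<comment> \<open>otherwise the orbit of \<open>x\<close> could be added: \<open>g\<close> takes the same positive value at all its residues\<close>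
  have full: "g i = 0" if x: "x \<in> addable r D" "has_residue i x" for x i
  proof (rule ccontr)
    assume "g i \<noteq> 0"
    then have gi: "0 < g i" using g0[of i] by simp
    obtain D' where D': "diagram r D'" "stable D'" "D \<union> {x} \<subseteq> D'" and
      cnt: "\<And>j. residue_count D' j = residue_count D j + (if int h dvd j - i then int (card {x}) else 0)"
      using add_shift_orbits[OF D, of "{x}" i] x by blast
    have "residue_count D' j \<le> residue_count D0 j" for j
      using cnt[of j] g0[of j] gi periodic_int[of g "int h" j i, OF gh] by (auto simp: g_def)
    then have "card D' \<le> card D" using max D' unfolding ok_def by blast
    have "x \<notin> D" using x unfolding addable_def by blast
    then have "D \<subset> D'" using D'(3) by blast
    from psubset_card_mono[OF diagramD(1)[OF D'(1)] this] \<open>card D' \<le> card D\<close>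
    show False by simp
  qed
  have convex: "2 * g i \<le> g (i - 1) + g (i + 1)" if "g i > 0" for i
  proof -
    have "{x \<in> addable r D. has_residue i x} = {}" using full[of _ i] that by force
    then have "residue_count (addable r D) i = 0"
      unfolding residue_count_def by (simp only: card.empty of_nat_0)
    then have "charge_count i - 2 * residue_count D i + residue_count D (i - 1) + residue_count D (i + 1) \<le> 0"
      using addable_minus_removable[OF D(1), of i] residue_count_nonneg[of "removable D" i] by simp
    then show ?thesis using dom[of i] unfolding g_def by simp
  qed
  have "g j = 0" for j
  proof (rule ccontr)
    assume "g j \<noteq> 0"
    define M where "M = Max (g ` {0..<int e})"
    have M: "M \<in> g ` {0..<int e}" unfolding M_def using e_pos by (intro Max_in) auto
    have le: "g k \<le> M" for k
    proof -
      have "int h dvd k - k mod int e" by (simp add: e_eq minus_mod_eq_mult_div)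
      then have "g k = g (k mod int e)" by (rule periodic_int[of g "int h", OF gh])
      then show ?thesis unfolding M_def using e_pos by (intro Max_ge) auto
    qed
    have Mpos: "M > 0" using le[of j] g0[of j] \<open>g j \<noteq> 0\<close> by simp
    obtain k0 where k0: "g k0 = M" using M by blast
    have "g k = M" for k
    proof (induction k rule: int_induct[where k = k0])
      case (step1 k)
      then show ?case using convex[of k] le[of "k - 1"] le[of "k + 1"] Mpos by simp
    next
      case (step2 k)
      then show ?case using convex[of k] le[of "k - 1"] le[of "k + 1"] Mpos by simp
    qed (rule k0)
    moreover obtain a b c where "(a, b, c) \<in> addable r D"
      using addable_nonempty[OF D(1) r_pos] by auto
    moreover have "has_residue (int b - int a + int (\<kappa> c)) (a, b, c)" by (simp add: has_residue_def)
    ultimately show False using full Mpos by fastforce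
  qed
  then have "residue_count D = residue_count D0" unfolding g_def by (intro ext) (simp add: eq_iff)
  then show ?thesis using D by blast
qed

text \<open>
  Induction on the size reduces to the dominant case: a negative pairing is made positive by the
  reflections at the residues congruent to \<open>i\<close> modulo \<open>h\<close>.
\<close>

lemma stable_diagram_exists:
  assumes "diagram r D0" "\<And>j. residue_count D0 (j + int h) = residue_count D0 j"
  shows "\<exists>D. diagram r D \<and> stable D \<and> residue_count D = residue_count D0"
  using assms
proof (induction "card D0" arbitrary: D0 rule: less_induct)
  case less
  note D0 = less.prems(1) and per = less.prems(2)
  define P where "P i = charge_count i - 2 * residue_count D0 i + residue_count D0 (i - 1)
                + residue_count D0 (i + 1)" for i
  show ?case
  proof (cases "\<forall>i. 0 \<le> P i")
    case True
    then show ?thesis using stable_diagram_dominant[OF D0 per] unfolding P_def by blast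
  next
    case False
    then obtain i where i: "P i < 0" by (meson not_le)
    define m where "m = nat (- P i)"
    have m: "int m = - P i" "0 < m" using i by (simp_all add: m_def)
    have Ph: "P (j + int h) = P j" for j
      using per[of j] per[of "j - 1"] per[of "j + 1"] charge_count_periodic[of j]
      unfolding P_def by (simp add: algebra_simps)
    \<comment> \<open>For \<open>h = 1\<close> the content is constant and no pairing is negative. Otherwise the residues
        congruent to \<open>i\<close> are pairwise not adjacent, so that changing their counts turns the
        pairing \<open>-m\<close> into \<open>-m + 2m\<close>.\<close>
    have h1: "\<not> int h dvd 1"
    proof
      assume "int h dvd 1"
      then have "residue_count D0 (i - 1) = residue_count D0 i" "residue_count D0 (i + 1) = residue_count D0 i"
        by (auto intro!: periodic_int[of "residue_count D0" "int h", OF per])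
      then show False using i unfolding P_def charge_count_def by simp
    qed
    \<comment> \<open>\<open>D0\<close> need not be invariant, so the nodes to remove are chosen for each residue separately\<close>
    have "\<exists>X. X \<subseteq> {x \<in> removable D0. has_residue (i + int k * int h) x} \<and> card X = m" for k
    proof -
      have "P (i + int k * int h) = P i" by (rule periodic_int[of P "int h", OF Ph]) simp
      then have "int m \<le> residue_count (removable D0) (i + int k * int h)"
        using addable_minus_removable[OF D0, of "i + int k * int h"] m(1)
          residue_count_nonneg[of "addable r D0" "i + int k * int h"] unfolding P_def by linarith
      then have "m \<le> card {x \<in> removable D0. has_residue (i + int k * int h) x}"
        unfolding residue_count_def by simp
      from obtain_subset_with_card_n[OF this] show ?thesis by blast
    qed
    then obtain X where X: "\<And>k. X k \<subseteq> {x \<in> removable D0. has_residue (i + int k * int h) x}"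
      "\<And>k. card (X k) = m" by metis
    define U where "U = (\<Union>k<p. X k)"
    have cU: "residue_count U j = (if int h dvd j - i then int m else 0)" for j
      unfolding U_def using X by (intro residue_count_layers) blast
    have UR: "U \<subseteq> removable D0" using X unfolding U_def by blast
    then have UD: "U \<subseteq> D0" unfolding removable_def by blast
    have fin: "finite D0" using diagramD(1)[OF D0] .
    have D1: "diagram r (D0 - U)" using diagram_remove[OF D0 UR] .
    have "residue_count (D0 - U \<union> U) j = residue_count (D0 - U) j + residue_count U j" for j
      using fin UD finite_subset by (intro residue_count_Un) auto
    then have c1: "residue_count (D0 - U) j = residue_count D0 j - (if int h dvd j - i then int m else 0)" for j
      using UD cU[of j] by (simp add: Un_absorb2)
    have "int h dvd j + int h - i \<longleftrightarrow> int h dvd j - i" for j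
      by (metis add_diff_eq diff_add_eq dvd_add_triv_right_iff)
    then have per1: "residue_count (D0 - U) (j + int h) = residue_count (D0 - U) j" for j
      unfolding c1 using per by simp
    have "U \<noteq> {}" using X(2)[of 0] m(2) pos(3) unfolding U_def by fastforce
    then have "card (D0 - U) < card D0" using UD fin by (intro psubset_card_mono) auto
    then obtain D2 where D2: "diagram r D2" "stable D2" "residue_count D2 = residue_count (D0 - U)"
      using less.hyps[OF _ D1 per1] by blast
    have "\<not> int h dvd (i - 1) - i" "\<not> int h dvd (i + 1) - i" using h1 by simp_all
    then have "residue_count (addable r D2) i - residue_count (removable D2) i = int m"
      using addable_minus_removable[OF D2(1), of i] m(1) unfolding D2(3) c1 P_def by simp
    then have "int m \<le> residue_count (addable r D2) i"
      using residue_count_nonneg[of "removable D2" i] by linarith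
    then have "m \<le> card {x \<in> addable r D2. has_residue i x}"
      unfolding residue_count_def by simp
    from obtain_subset_with_card_n[OF this] obtain Y
      where Y: "Y \<subseteq> {x \<in> addable r D2. has_residue i x}" "card Y = m" by blast
    have "Y \<subseteq> addable r D2" "\<And>x. x \<in> Y \<Longrightarrow> has_residue i x" using Y(1) by blast+
    from add_shift_orbits[OF D2(1,2) this] obtain D' where D': "diagram r D'" "stable D'" and
      "\<And>j. residue_count D' j = residue_count D2 j + (if int h dvd j - i then int (card Y) else 0)"
      by blast
    then have "residue_count D' = residue_count D0"
      unfolding D2(3) c1 Y(2) by (intro ext) simp
    then show ?thesis using D' by blast
  qed
qed

end


section \<open>From diagrams back to multipartitions\<close>

lemma sorted_antimono_iff:
  "sorted_wrt (\<ge>) (\<mu> :: nat list) \<longleftrightarrow> (\<forall>i j. i \<le> j \<and> j < length \<mu> \<longrightarrow> \<mu> ! j \<le> \<mu> ! i)"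
  by (auto simp: sorted_wrt_iff_nth_less le_less)

lemma diagram_young:
  assumes "lam \<in> multipartitions r n"
  shows "diagram r (young lam)" "card (young lam) = n"
proof -
  have len: "length lam = r" and part: "\<And>c. c < r \<Longrightarrow> is_partition (lam ! c)"
    and size: "sum_list (map sum_list lam) = n"
    using assms unfolding multipartitions_def by auto
  have young_eq: "young lam = (\<lambda>(c, a, b). (a, b, c)) ` (SIGMA c:{..<r}. SIGMA a:{..<length (lam ! c)}. {..<lam ! c ! a})"
    unfolding young_def len by force
  show "diagram r (young lam)"
  proof (rule diagramI)
    show "finite (young lam)" unfolding young_eq by blast
    show "(a, b, c) \<in> young lam" if "(Suc a, b, c) \<in> young lam" for a b c
      using that part[of c] sorted_antimono_iff[of "lam ! c"] unfolding young_def is_partition_def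
      by (auto simp: len elim: less_le_trans)
  qed (auto simp: young_def len)
  have "card (young lam) = card (SIGMA c:{..<r}. SIGMA a:{..<length (lam ! c)}. {..<lam ! c ! a})"
    unfolding young_eq by (rule card_image) (auto simp: inj_on_def)
  also have "\<dots> = n"
    by (simp add: size[symmetric] sum_list_sum_nth len atLeast0LessThan)
  finally show "card (young lam) = n" .
qed

definition rows_of_diagram :: "nat \<Rightarrow> node set \<Rightarrow> multipartition" where
  "rows_of_diagram r D =
     map (\<lambda>c. map (\<lambda>a. card {b. (a, b, c) \<in> D}) [0..<card {a. (a, 0, c) \<in> D}]) [0..<r]"

lemma finite_down_set_eq_lessThan:
  fixes S :: "nat set"
  assumes "finite S" "\<And>x y. x \<in> S \<Longrightarrow> y \<le> x \<Longrightarrow> y \<in> S"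
  shows "S = {..<card S}"
proof -
  obtain k where "k \<notin> S" using assms(1) ex_new_if_finite infinite_UNIV_nat by blast
  define m where "m = (LEAST k. k \<notin> S)"
  have "m \<notin> S" unfolding m_def using \<open>k \<notin> S\<close> by (rule LeastI)
  moreover have "x \<in> S" if "x < m" for x using that not_less_Least unfolding m_def by blast
  moreover have "x < m" if "x \<in> S" for x using that \<open>m \<notin> S\<close> assms(2)[of x m] by linarith
  ultimately have "S = {..<m}" by blast
  then show ?thesis by simp
qed

lemma rows_of_diagram:
  assumes D: "diagram r D"
  shows "young (rows_of_diagram r D) = D" "rows_of_diagram r D \<in> multipartitions r (card D)"
proof -
  let ?lam = "rows_of_diagram r D"
  have finr: "finite {b. (a, b, c) \<in> D}" for a c
    by (rule finite_subset[OF _ finite_imageI[OF diagramD(1)[OF D], of "\<lambda>(a, b, c). b"]]) force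
  have finc: "finite {a. (a, 0, c) \<in> D}" for c
    by (rule finite_subset[OF _ finite_imageI[OF diagramD(1)[OF D], of "\<lambda>(a, b, c). a"]]) force
  have row: "{b. (a, b, c) \<in> D} = {..<card {b. (a, b, c) \<in> D}}" for a c
    by (rule finite_down_set_eq_lessThan[OF finr]) (use diagramD(3)[OF D] in auto)
  have col: "{a. (a, 0, c) \<in> D} = {..<card {a. (a, 0, c) \<in> D}}" for c
    by (rule finite_down_set_eq_lessThan[OF finc]) (use diagramD(3)[OF D] in auto)
  have row_iff: "(a, b, c) \<in> D \<longleftrightarrow> b < card {b. (a, b, c) \<in> D}" for a b c using row[of a c] by blast
  have col_iff: "(a, 0, c) \<in> D \<longleftrightarrow> a < card {a. (a, 0, c) \<in> D}" for a c using col[of c] by blast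
  have mem: "(a, b, c) \<in> young ?lam \<longleftrightarrow> (a, b, c) \<in> D" for a b c
  proof -
    have "(a, b, c) \<in> young ?lam \<longleftrightarrow> c < r \<and> (a, 0, c) \<in> D \<and> (a, b, c) \<in> D"
      using row_iff[of a b c] col_iff[of a c] by (auto simp: young_def rows_of_diagram_def)
    then show ?thesis using diagramD(2,3)[OF D] by blast
  qed
  then show young: "young ?lam = D" by auto
  have "is_partition \<mu>" if mu: "\<mu> \<in> set ?lam" for \<mu>
  proof -
    obtain c where c: "\<mu> = map (\<lambda>a. card {b. (a, b, c) \<in> D}) [0..<card {a. (a, 0, c) \<in> D}]"
      using mu unfolding rows_of_diagram_def by auto
    have "card {b. (a', b, c) \<in> D} \<le> card {b. (a, b, c) \<in> D}" if "a \<le> a'" for a a'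
      using diagramD(3)[OF D] that by (intro card_mono[OF finr]) auto
    moreover have "card {b. (a, b, c) \<in> D} \<noteq> 0" if "a < card {a. (a, 0, c) \<in> D}" for a
      using that col_iff[of a c] row_iff[of a 0 c] by simp
    ultimately show ?thesis unfolding is_partition_def sorted_antimono_iff
      unfolding c by (auto, metis less_irrefl)
  qed
  then have "?lam \<in> multipartitions r (sum_list (map sum_list ?lam))"
    unfolding multipartitions_def by (auto simp: rows_of_diagram_def)
  moreover from diagram_young(2)[OF this] have "sum_list (map sum_list ?lam) = card D"
    using young by simp
  ultimately show "?lam \<in> multipartitions r (card D)" by simp
qed

lemma content_eq_image_mset:
  "content e \<kappa> lam = image_mset (residue e \<kappa>) (mset_set (young lam))"
proof -
  have "(\<Sum>\<gamma>\<in>A. {#f \<gamma>#}) = image_mset f (mset_set A)" for A :: "node set" and f :: "node \<Rightarrow> nat"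
    by (induction A rule: infinite_finite_induct) auto
  then show ?thesis unfolding content_def .
qed

context multicharge
begin

lemma count_content:
  assumes "0 < e" "finite (young lam)"
  shows "count (content e \<kappa> lam) i = (if i < e then nat (residue_count (young lam) (int i)) else 0)"
proof -
  have eq: "residue e \<kappa> x = i \<longleftrightarrow> i < e \<and> has_residue (int i) x" for x
  proof -
    obtain a b c where x: "x = (a, b, c)" by (cases x)
    let ?t = "int b - int a + int (\<kappa> c)"
    have "nat (?t mod int e) = i \<longleftrightarrow> ?t mod int e = int i" using assms(1) by auto
    also have "\<dots> \<longleftrightarrow> i < e \<and> ?t mod int e = int i mod int e"
      using assms(1) by (metis mod_pos_pos_trivial of_nat_0_le_iff of_nat_0_less_iff of_nat_less_iff pos_mod_bound)
    finally show ?thesis unfolding x residue_def has_residue_def by (simp add: mod_eq_dvd_iff)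
  qed
  have "count (content e \<kappa> lam) i = card {x \<in> young lam. residue e \<kappa> x = i}"
    unfolding content_eq_image_mset count_image_mset
    using assms(2) by (simp add: Int_def vimage_def conj_commute)
  then show ?thesis unfolding eq residue_count_def by simp
qed

lemma content_eq_iff:
  assumes "0 < e" "finite (young lam)" "finite (young lam')"
  shows "content e \<kappa> lam = content e \<kappa> lam' \<longleftrightarrow>
    residue_count (young lam) = residue_count (young lam')"
proof
  assume eq: "content e \<kappa> lam = content e \<kappa> lam'"
  show "residue_count (young lam) = residue_count (young lam')"
  proof
    fix j :: int
    define i where "i = nat (j mod int e)"
    have i: "i < e" "int i = j mod int e" using assms(1) by (simp_all add: i_def nat_less_iff)
    then have "int e dvd j - int i" by (simp add: minus_mod_eq_mult_div)
    moreover have "nat (residue_count (young lam) (int i)) = nat (residue_count (young lam') (int i))"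
      using eq i(1) count_content[OF assms(1,2), of i] count_content[OF assms(1,3), of i] by simp
    then have "residue_count (young lam) (int i) = residue_count (young lam') (int i)"
      using residue_count_nonneg by (simp add: eq_nat_nat_iff)
    ultimately show "residue_count (young lam) j = residue_count (young lam') j"
      using residue_count_cong by metis
  qed
next
  assume "residue_count (young lam) = residue_count (young lam')"
  then show "content e \<kappa> lam = content e \<kappa> lam'"
    by (intro multiset_eqI) (simp add: count_content assms)
qed

end

lemma young_rotate:
  "(a, b, c) \<in> young (rotate k lam) \<longleftrightarrow> c < length lam \<and> (a, b, (k + c) mod length lam) \<in> young lam"
  by (cases "lam = []") (auto simp: young_def nth_rotate)

lemma multipartition_shift_funpow:
  assumes "length lam = d * p" "d \<ge> 1" "p \<ge> 1"
  shows "(multipartition_shift d ^^ k) lam = rotate (k * (d * p - d)) lam"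
proof -
  have "multipartition_shift d xs = rotate (d * p - d) xs" if "length xs = d * p" for xs
    using that assms(2,3) by (simp add: multipartition_shift_def rotate_drop_take)
  then show ?thesis by (induction k) (simp_all add: assms(1) rotate_rotate)
qed

lemma multipartition_shift_funpow_in:
  assumes "lam \<in> multipartitions r n"
  shows "(multipartition_shift d ^^ k) lam \<in> multipartitions r n"
proof (induction k)
  case (Suc k)
  define xs where "xs = (multipartition_shift d ^^ k) lam"
  define j where "j = length xs - d"
  have "sum_list (map sum_list (drop j xs @ take j xs)) = sum_list (map sum_list xs)"
    by (metis append_take_drop_id map_append sum_list_append add.commute)
  moreover have "set (drop j xs @ take j xs) = set xs"
    by (metis append_take_drop_id set_append Un_commute)
  ultimately have "drop j xs @ take j xs \<in> multipartitions r n"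
    using Suc.IH unfolding xs_def[symmetric] multipartitions_def
    by (simp del: set_append map_append)
  then show ?case by (simp add: xs_def[symmetric] j_def multipartition_shift_def[of d xs])
qed (use assms in simp)

text \<open>
  On lists, the shift of components by \<open>\<delta>\<close> is any rotation by \<open>k\<close> with \<open>k \<equiv> -\<delta>\<close> modulo \<open>r\<close>: rotating a
  list moves its entries towards the front.
\<close>

context periodic_multicharge
begin

lemma shift_image_young_rotate:
  assumes "length lam = r" "int r dvd int k + int \<delta>"
  shows "young (rotate k lam) = shift ` young lam"
proof -
  have m: "(k + (c + \<delta>) mod r) mod r = c" "((k + c) mod r + \<delta>) mod r = c" if "c < r" for c
  proof -
    have "r dvd k + \<delta>" using assms(2) by (metis of_nat_add of_nat_dvd_iff)
    then obtain t where t: "k + \<delta> = r * t" by (rule dvdE)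
    have "(k + c + \<delta>) mod r = (c + r * t) mod r" by (simp only: t[symmetric] ac_simps)
    then have "(k + c + \<delta>) mod r = c" using that by simp
    then show "(k + (c + \<delta>) mod r) mod r = c" "((k + c) mod r + \<delta>) mod r = c"
      by (simp_all add: mod_simps ac_simps)
  qed
  show ?thesis
  proof (intro equalityI subsetI)
    fix x assume x: "x \<in> young (rotate k lam)"
    obtain a b c where abc: "x = (a, b, c)" by (cases x)
    have "c < r" "(a, b, (k + c) mod r) \<in> young lam" using x young_rotate assms(1) unfolding abc by auto
    then show "x \<in> shift ` young lam"
      using m(2)[of c] unfolding abc by (intro image_eqI[of _ _ "(a, b, (k + c) mod r)"]) (simp_all add: shift_def)
  next
    fix x assume "x \<in> shift ` young lam"
    then obtain a b c where abc: "x = (a, b, (c + \<delta>) mod r)" "(a, b, c) \<in> young lam"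
      unfolding shift_def by auto
    then have "c < r" using assms(1) by (simp add: young_def)
    then show "x \<in> young (rotate k lam)"
      using abc m(1)[of c] r_pos by (simp add: young_rotate assms(1))
  qed
qed

lemma residue_shift: "c < r \<Longrightarrow> residue e \<kappa> (shift (a, b, c)) = (residue e \<kappa> (a, b, c) + h) mod e"
proof -
  assume c: "c < r"
  let ?t = "int b - int a + int (\<kappa> c)"
  have "(int b - int a + int (\<kappa> ((c + \<delta>) mod r))) - (?t + int h) =
      int (\<kappa> ((c + \<delta>) mod r)) - int (\<kappa> c) - int h" by simp
  then have "(int b - int a + int (\<kappa> ((c + \<delta>) mod r))) mod int e = (?t + int h) mod int e"
    using charge_shift[OF c] by (simp only: mod_eq_dvd_iff)
  also have "\<dots> = int ((nat (?t mod int e) + h) mod e)"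
    using e_pos by (simp add: zmod_int mod_simps)
  finally show ?thesis unfolding residue_def shift_def by simp
qed

lemma inj_on_shift: "inj_on shift {(a, b, c). c < r}"
  by (rule inj_on_inverseI[where g = "shift ^^ (p - 1)"]) (use shift_pow_pred(1) in auto)

lemma content_rotate:
  assumes "length lam = r" "int r dvd int k + int \<delta>"
  shows "content e \<kappa> (rotate k lam) = content_shift e h (content e \<kappa> lam)"
proof -
  have sub: "young lam \<subseteq> {(a, b, c). c < r}" using assms(1) by (auto simp: young_def)
  have "mset_set (young (rotate k lam)) = image_mset shift (mset_set (young lam))"
    unfolding shift_image_young_rotate[OF assms]
    by (rule image_mset_mset_set[symmetric]) (rule inj_on_subset[OF inj_on_shift sub])
  moreover have "residue e \<kappa> (shift x) = (residue e \<kappa> x + h) mod e" if "x \<in># mset_set (young lam)" for x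
    using that sub residue_shift by (cases "finite (young lam)") auto
  moreover from this have "image_mset (\<lambda>x. residue e \<kappa> (shift x)) (mset_set (young lam)) =
      image_mset (\<lambda>x. (residue e \<kappa> x + h) mod e) (mset_set (young lam))"
    by (rule image_mset_cong)
  ultimately show ?thesis
    unfolding content_eq_image_mset content_shift_def by (simp add: multiset.map_comp comp_def)
qed

lemma residue_count_shift_image:
  assumes "\<And>a b c. (a, b, c) \<in> D \<Longrightarrow> c < r"
  shows "residue_count (shift ` D) (j + int h) = residue_count D j"
proof -
  have sub: "D \<subseteq> {(a, b, c). c < r}" using assms by auto
  have "{x \<in> shift ` D. has_residue (j + int h) x} = shift ` {x \<in> D. has_residue j x}"
    using sub has_residue_shift by (auto; blast)
  moreover have "card (shift ` {x \<in> D. has_residue j x}) = card {x \<in> D. has_residue j x}"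
    using sub by (intro card_image inj_on_subset[OF inj_on_shift]) auto
  ultimately show ?thesis unfolding residue_count_def by simp
qed

text \<open>
  Invariance of the content of \<open>lam\<close> under the shift makes its residue counts periodic, as the diagram
  of the rotated multipartition is the shifted diagram; this is what \<open>stable_diagram_exists\<close> needs.
\<close>

lemma invariant_multipartition_exists:
  assumes lam: "lam \<in> multipartitions r n" and k: "int r dvd int k + int \<delta>"
    and inv: "content e \<kappa> (rotate k lam) = content e \<kappa> lam"
  shows "\<exists>mu \<in> multipartitions r n. content e \<kappa> mu = content e \<kappa> lam \<and> rotate k mu = mu"
proof -
  have len: "length lam = r" using lam by (simp add: multipartitions_def)
  note D0 = diagram_young[OF lam] and rot = shift_image_young_rotate[OF len k]
  have fin: "finite (young lam)" "finite (young (rotate k lam))"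
    using diagramD(1)[OF D0(1)] rot by simp_all
  have "residue_count (young lam) (j + int h) = residue_count (young lam) j" for j
    using residue_count_shift_image[of "young lam" j] diagramD(2)[OF D0(1)] inv rot
      content_eq_iff[OF e_pos fin(2,1)] by simp
  from stable_diagram_exists[OF D0(1) this] obtain D
    where D: "diagram r D" "stable D" and cnt: "residue_count D = residue_count (young lam)" by blast
  define mu where "mu = rows_of_diagram r D"
  have mu: "young mu = D" "mu \<in> multipartitions r (card D)"
    unfolding mu_def by (rule rows_of_diagram[OF D(1)])+
  have cont: "content e \<kappa> mu = content e \<kappa> lam"
    using content_eq_iff[OF e_pos, of mu lam] fin(1) diagramD(1)[OF D(1)] mu(1) cnt by simp
  have "size (content e \<kappa> mu) = card (young mu)" for mu by (simp add: content_eq_image_mset)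
  then have "card D = n" using cont mu(1) D0(2) by metis
  moreover have "rotate k mu = mu"
  proof (rule nth_equalityI)
    fix c assume "c < length (rotate k mu)"
    then have c: "c < r" by (simp add: mu_def rows_of_diagram_def)
    have "rotate k mu ! c = mu ! ((k + c) mod r)"
      using c nth_rotate[of c mu k] by (simp add: mu_def rows_of_diagram_def)
    also have "\<dots> = mu ! (((k + c) mod r + \<delta>) mod r)"
      using stable_shift_iff[OF D(2), of "(k + c) mod r"] r_pos by (simp add: mu_def rows_of_diagram_def)
    also have "((k + c) mod r + \<delta>) mod r = c"
    proof -
      obtain t where t: "k + \<delta> = r * t" using k by (metis of_nat_add of_nat_dvd_iff dvdE)
      have "(k + c + \<delta>) mod r = (c + r * t) mod r" by (simp only: t[symmetric] ac_simps)
      then show ?thesis using c by (simp add: mod_simps ac_simps)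
    qed
    finally show "rotate k mu ! c = mu ! c" .
  qed simp
  ultimately show ?thesis using mu(2) cont by blast
qed

end

section \<open>Orbits\<close>

lemma card_shift_orbit_le:
  assumes "m \<ge> 1" "(f ^^ m) x = x"
  shows "card (shift_orbit f x) \<le> m"
  using card_shift_orbit_dvd[OF assms] assms(1) by (simp add: dvd_imp_le)

text \<open>
  Two of the first \<open>c + 1\<close> iterates coincide, where \<open>c\<close> is the orbit length; as the iteration is
  invertible along the orbit, their distance is a period. It is at most \<open>c\<close>, and by
  \<open>card_shift_orbit_le\<close> at least \<open>c\<close>.
\<close>

lemma funpow_card_shift_orbit:
  assumes "p \<ge> 1" "(f ^^ p) x = x"
  shows "card (shift_orbit f x) \<ge> 1" "(f ^^ card (shift_orbit f x)) x = x"
proof -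
  have "shift_orbit f x \<subseteq> (\<lambda>k. (f ^^ k) x) ` {..<p}"
  proof
    fix y assume "y \<in> shift_orbit f x"
    then obtain k where "y = (f ^^ k) x" unfolding shift_orbit_def by blast
    then have "y = (f ^^ (k mod p)) x" using funpow_mod_eq[OF assms(2)] by metis
    then show "y \<in> (\<lambda>k. (f ^^ k) x) ` {..<p}" using assms(1) by (intro image_eqI) auto
  qed
  then have fin: "finite (shift_orbit f x)" by (rule finite_subset) simp
  let ?c = "card (shift_orbit f x)"
  have "x \<in> shift_orbit f x" unfolding shift_orbit_def by (rule image_eqI[of _ _ 0]) simp_all
  then show "?c \<ge> 1" using fin by (metis One_nat_def Suc_leI card_gt_0_iff empty_iff)
  have "\<not> inj_on (\<lambda>k. (f ^^ k) x) {..?c}"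
  proof
    assume "inj_on (\<lambda>k. (f ^^ k) x) {..?c}"
    then have "card {..?c} \<le> ?c"
      by (rule card_inj_on_le) (use fin in \<open>auto simp: shift_orbit_def\<close>)
    then show False by simp
  qed
  then obtain i j where ij: "i < j" "j \<le> ?c" "(f ^^ i) x = (f ^^ j) x"
    unfolding inj_on_def by (metis atMost_iff linorder_neqE_nat)
  have "i \<le> p * i" using assms(1) by simp
  have pi: "(f ^^ (p * i)) x = x" using funpow_mod_eq[OF assms(2), of "p * i"] by simp
  have "(f ^^ (j - i)) x = (f ^^ (j - i)) ((f ^^ (p * i - i)) ((f ^^ i) x))"
    using pi \<open>i \<le> p * i\<close> by (metis comp_apply funpow_add le_add_diff_inverse2)
  also have "\<dots> = (f ^^ (p * i - i)) ((f ^^ (j - i)) ((f ^^ i) x))"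
    by (metis add.commute comp_apply funpow_add)
  also have "(f ^^ (j - i)) ((f ^^ i) x) = (f ^^ i) x"
    using ij by (metis comp_apply funpow_add le_add_diff_inverse2 less_imp_le)
  also have "(f ^^ (p * i - i)) ((f ^^ i) x) = x"
    using pi \<open>i \<le> p * i\<close> by (metis comp_apply funpow_add le_add_diff_inverse2)
  finally have period: "(f ^^ (j - i)) x = x" .
  then have "?c \<le> j - i" using ij by (intro card_shift_orbit_le) simp_all
  then have "j - i = ?c" using ij by simp
  then show "(f ^^ ?c) x = x" using period by simp
qed

lemma shift_orbit_funpow:
  assumes "p \<ge> 1" "(f ^^ p) x = x"
  shows "shift_orbit f ((f ^^ k) x) = shift_orbit f x"
proof (intro equalityI subsetI)
  fix y assume "y \<in> shift_orbit f ((f ^^ k) x)"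
  then obtain l where "y = (f ^^ l) ((f ^^ k) x)" unfolding shift_orbit_def by blast
  then have "y = (f ^^ (l + k)) x" by (simp add: funpow_add)
  then show "y \<in> shift_orbit f x" unfolding shift_orbit_def by blast
next
  fix y assume "y \<in> shift_orbit f x"
  then obtain l where y: "y = (f ^^ l) x" unfolding shift_orbit_def by blast
  have "k \<le> p * k" using assms(1) by simp
  have "(f ^^ (p * k)) x = x" using funpow_mod_eq[OF assms(2), of "p * k"] by simp
  then have "(f ^^ (p * k - k)) ((f ^^ k) x) = x"
    using \<open>k \<le> p * k\<close> by (metis comp_apply funpow_add le_add_diff_inverse2)
  then have "y = (f ^^ (l + (p * k - k))) ((f ^^ k) x)" using y by (simp add: funpow_add)
  then show "y \<in> shift_orbit f ((f ^^ k) x)" unfolding shift_orbit_def by blast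
qed

text \<open>
  The \<open>m\<close>-th power of the shift, for a divisor \<open>m\<close> of \<open>p\<close>: the charge relation is iterated \<open>m\<close> times.
\<close>

lemma periodic_multicharge_multiple:
  assumes "d \<ge> 1" "\<eta> \<ge> 1" "p = m * t" "p \<ge> 1"
    and \<kappa>: "\<And>k. k < d * p \<Longrightarrow> \<kappa> ((k + d) mod (d * p)) = (\<kappa> k + \<eta>) mod (\<eta> * p)"
  shows "periodic_multicharge (\<eta> * p) (d * p) \<kappa> (m * d) (m * \<eta>) t"
proof
  have "0 < m" "0 < t" using assms(3,4) by (auto intro: gr0I)
  then show "0 < m * \<eta>" "0 < m * d" "0 < t" using assms(1,2) by simp_all
  show "\<eta> * p = m * \<eta> * t" "d * p = m * d * t" using assms(3) by simp_all
  fix c assume c: "c < d * p"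
  have r: "0 < d * p" using c by linarith
  show "int (\<eta> * p) dvd int (\<kappa> ((c + m * d) mod (d * p))) - int (\<kappa> c) - int (m * \<eta>)"
  proof (induction m)
    case 0
    then show ?case using c by simp
  next
    case (Suc m)
    let ?c = "(c + m * d) mod (d * p)"
    have "(c + Suc m * d) mod (d * p) = (?c + d) mod (d * p)" by (simp add: mod_simps ac_simps)
    then have "int (\<kappa> ((c + Suc m * d) mod (d * p))) = (int (\<kappa> ?c) + int \<eta>) mod int (\<eta> * p)"
      using \<kappa>[of ?c] r by (simp add: zmod_int)
    then have "int (\<eta> * p) dvd int (\<kappa> ((c + Suc m * d) mod (d * p))) - (int (\<kappa> ?c) + int \<eta>)"
      by (metis mod_eq_dvd_iff mod_mod_trivial)
    from dvd_add[OF this Suc.IH] show ?case by (simp add: algebra_simps)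
  qed
qed

theorem proposition5p35:
  fixes d \<eta> p n e r :: nat
    and \<kappa> :: "nat \<Rightarrow> nat"
    and q \<zeta> :: "'f::field"
    and \<sigma> star :: "(ak_gen, 'f) free_elt set \<Rightarrow> (ak_gen, 'f) free_elt set"
    and prec :: "multipartition \<Rightarrow> multipartition \<Rightarrow> bool"
    and C :: "multipartition \<Rightarrow> (node \<Rightarrow> nat) \<Rightarrow> (node \<Rightarrow> nat) \<Rightarrow> (ak_gen, 'f) free_elt set"
    and Specht :: "multipartition \<Rightarrow> ((ak_gen, 'f) free_elt set, (node \<Rightarrow> nat) \<Rightarrow> 'f) module"
    and Sub_Specht :: "multipartition \<Rightarrow> ((ak_gen, 'f) free_elt set, 'm) module list"
    and \<alpha> :: "nat multiset"
  assumes "d \<ge> 1" "\<eta> \<ge> 1" "p \<ge> 1" "n \<ge> 1"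
    and "e = \<eta> * p" "e \<ge> 2" "r = d * p"
    and "\<And>k. k < r \<Longrightarrow> \<kappa> k < e"
    and "\<And>k. k < r \<Longrightarrow> \<kappa> ((k + d) mod r) = (\<kappa> k + \<eta>) mod e"
    and "q \<noteq> 0" "q \<noteq> 1" "has_mult_order q e"
    and "\<zeta> \<noteq> 0" "has_mult_order \<zeta> p"
    and "ak_shift_automorphism q \<kappa> r n p \<zeta> \<sigma>"
    and "cellular_algebra (ariki_koike q \<kappa> r n) (ak_scalar q \<kappa> r n)
           (multipartitions r n) prec (standard_tableaux n) C star"
    and "\<And>lam. lam \<in> multipartitions r n \<Longrightarrow>
           Specht lam = cell_module (ariki_koike q \<kappa> r n) (ak_scalar q \<kappa> r n)
             (multipartitions r n) prec (standard_tableaux n) C lam"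
    and "\<And>lam. lam \<in> multipartitions r n \<Longrightarrow>
           length (Sub_Specht lam) = p div card (shift_orbit (multipartition_shift d) lam)"
    and "\<And>lam. lam \<in> multipartitions r n \<Longrightarrow>
           twisted_decomposition (fixed_subring (ariki_koike q \<kappa> r n) \<sigma>) (ak_scalar q \<kappa> r n)
             (Specht lam) (Sub_Specht lam)"
    and "\<alpha> \<in> contents e \<kappa> r n"
  shows "(\<forall>lam \<in> multipartitions_of_orbit e \<kappa> r n \<eta> \<alpha>.
            length (Sub_Specht lam) \<le> p div card (shift_orbit (content_shift e \<eta>) \<alpha>)) \<and>
         (\<exists>lam \<in> multipartitions_of_orbit e \<kappa> r n \<eta> \<alpha>.
            length (Sub_Specht lam) = p div card (shift_orbit (content_shift e \<eta>) \<alpha>))"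
  proof -
  note d = assms(1) and \<eta> = assms(2) and p = assms(3)
  let ?fa = "content_shift e \<eta>" and ?fl = "multipartition_shift d"
  have charge: "\<kappa> ((k + d) mod (d * p)) = (\<kappa> k + \<eta>) mod (\<eta> * p)" if "k < d * p" for k
    using assms(9)[of k] that assms(5,7) by simp
  interpret one: periodic_multicharge e r \<kappa> d \<eta> p
    using periodic_multicharge_multiple[of d \<eta> p 1 p \<kappa>] d \<eta> p charge assms(5,7) by simp
  have len: "length lam = r" if "lam \<in> multipartitions r n" for lam
    using that by (simp add: multipartitions_def)
  have pow: "(?fl ^^ k) lam = rotate (k * (r - d)) lam" if "lam \<in> multipartitions r n" for k lam
    using multipartition_shift_funpow[of lam d p k] len[OF that] d p assms(7) by simp
  have dr: "d \<le> r" using p assms(7) by simp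
  have dvd: "int r dvd int (k * (r - d)) + int (k * d)" for k
    using dr by (simp add: of_nat_diff algebra_simps)
  have equiv: "content e \<kappa> ((?fl ^^ k) lam) = (?fa ^^ k) (content e \<kappa> lam)"
    if lam: "lam \<in> multipartitions r n" for k lam
  proof (induction k)
    case (Suc k)
    have in_mp: "(?fl ^^ k) lam \<in> multipartitions r n" using lam by (rule multipartition_shift_funpow_in)
    have "?fl ((?fl ^^ k) lam) = rotate (r - d) ((?fl ^^ k) lam)" using pow[OF in_mp, of 1] by simp
    then show ?case
      using one.content_rotate[OF len[OF in_mp], of "r - d"] dvd[of 1] Suc.IH by simp
  qed simp
  have per_l: "(?fl ^^ p) lam = lam" if lam: "lam \<in> multipartitions r n" for lam
  proof -
    have "p * (r - d) = length lam * (p - 1)" using len[OF lam] assms(7) by (simp add: algebra_simps)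
    then show ?thesis unfolding pow[OF lam] by (simp add: rotate_id)
  qed
  have per_a: "(?fa ^^ p) (content e \<kappa> lam) = content e \<kappa> lam" if "lam \<in> multipartitions r n" for lam
    using equiv[OF that, of p] per_l[OF that] by simp
  obtain lam0 where lam0: "lam0 \<in> multipartitions r n" "\<alpha> = content e \<kappa> lam0"
    using assms(20) unfolding contents_def by blast
  define m where "m = card (shift_orbit ?fa \<alpha>)"
  have m: "m \<ge> 1" "(?fa ^^ m) \<alpha> = \<alpha>"
    using funpow_card_shift_orbit[OF p per_a[OF lam0(1)]] unfolding m_def lam0(2) by blast+
  \<comment> \<open>a power of the shift that fixes \<open>lam\<close> fixes its content, whose orbit is that of \<open>\<alpha>\<close>\<close>
  have lower: "m \<le> card (shift_orbit ?fl lam)" if orbit: "lam \<in> multipartitions_of_orbit e \<kappa> r n \<eta> \<alpha>" for lam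
  proof -
    obtain k where lam: "lam \<in> multipartitions r n" "content e \<kappa> lam = (?fa ^^ k) \<alpha>"
      using orbit unfolding multipartitions_of_orbit_def multipartitions_of_content_def shift_orbit_def
      by auto
    let ?c = "card (shift_orbit ?fl lam)"
    note c = funpow_card_shift_orbit[OF p per_l[OF lam(1)]]
    have "(?fa ^^ ?c) (content e \<kappa> lam) = content e \<kappa> lam" using equiv[OF lam(1), of ?c] c(2) by simp
    then have "card (shift_orbit ?fa (content e \<kappa> lam)) \<le> ?c" by (rule card_shift_orbit_le[OF c(1)])
    then show ?thesis
      using shift_orbit_funpow[OF p per_a[OF lam0(1)]] unfolding m_def lam(2) lam0(2) by simp
  qed
  have in_mp: "lam \<in> multipartitions r n" if "lam \<in> multipartitions_of_orbit e \<kappa> r n \<eta> \<alpha>" for lam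
    using that unfolding multipartitions_of_orbit_def multipartitions_of_content_def by blast
  have "m dvd p" unfolding m_def lam0(2) by (rule card_shift_orbit_dvd[OF p per_a[OF lam0(1)]])
  then obtain t where t: "p = m * t" by (rule dvdE)
  \<comment> \<open>for the \<open>m\<close>-th power of the shift, which fixes \<open>\<alpha>\<close>, an invariant multipartition exists\<close>
  interpret period: periodic_multicharge e r \<kappa> "m * d" "m * \<eta>" t
    using periodic_multicharge_multiple[of d \<eta> p m t \<kappa>, OF d \<eta> t p charge] assms(5,7) by simp
  have "content e \<kappa> (rotate (m * (r - d)) lam0) = content e \<kappa> lam0"
    using equiv[OF lam0(1), of m] pow[OF lam0(1), of m] m(2) lam0(2) by simp
  from period.invariant_multipartition_exists[OF lam0(1) dvd this]
  obtain mu where mu: "mu \<in> multipartitions r n" "content e \<kappa> mu = \<alpha>" "rotate (m * (r - d)) mu = mu"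
    unfolding lam0(2) by blast
  have "\<alpha> \<in> shift_orbit ?fa \<alpha>" unfolding shift_orbit_def by (rule image_eqI[of _ _ 0]) simp_all
  then have mu_orbit: "mu \<in> multipartitions_of_orbit e \<kappa> r n \<eta> \<alpha>"
    using mu unfolding multipartitions_of_orbit_def multipartitions_of_content_def by blast
  have "card (shift_orbit ?fl mu) \<le> m"
    using pow[OF mu(1), of m] mu(3) by (intro card_shift_orbit_le[OF m(1)]) simp
  then have "card (shift_orbit ?fl mu) = m" using lower[OF mu_orbit] by simp
  then have "length (Sub_Specht mu) = p div m" using assms(18)[OF mu(1)] by simp
  moreover have "length (Sub_Specht lam) \<le> p div m"
    if "lam \<in> multipartitions_of_orbit e \<kappa> r n \<eta> \<alpha>" for lam
    using assms(18)[OF in_mp[OF that]] lower[OF that] m(1) by (simp add: div_le_mono2)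
  ultimately show ?thesis using mu_orbit unfolding m_def by blast
qed

end
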